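(* Let $d_1,d_2\ge1$ be integers, let $\mu>-\tfrac12$ and let $\boldsymbol\kappa=(\kappa_1,\dots,\kappa_{d_2-1})\in\mathbb{R}^{d_2-1}$ with $\kappa_i>-1$ for $1\le i\le d_2-1$; set $\kappa_{d_2}:=0$. Define $$ \begin{aligned} \mathfrak{D}_{\mu,\boldsymbol\kappa}^{\mathbb{B}\rtimes\Sigma}u:={}&|y|\Delta_xu+2\langle x,\nabla_x\rangle\partial_{y_{d_2}}u-\langle x,\nabla_x\rangle u+\sum_{i=1}^{d_2}\big(y_i\partial_{y_i}^2+(\kappa_i+1-y_i)\partial_{y_i}\big)u\\ &+2|y|\partial_{y_{d_2}}^2u-2\langle y,\nabla_y\rangle\partial_{y_{d_2}}u+(2\mu+d_1-|\boldsymbol\kappa|-d_2)\partial_{y_{d_2}}u . \end{aligned} $$ Then, for each $n\in\mathbb{N}_0$, $\mathcal{V}_n\big(\mathbb{B}^{d_1}\rtimes\mathbb{R}_\Sigma^{d_2},W_{\mu,\boldsymbol\kappa}^{\mathbb{B}\rtimes\Sigma}\big)$ is an eigenspace of $\mathfrak{D}_{\mu,\boldsymbol\kappa}^{\mathbb{B}\rtimes\Sigma}$; more precisely, $$ \mathfrak{D}_{\mu,\boldsymbol\kappa}^{\mathbb{B}\rtimes\Sigma}u=-n\,u\qquad\text{for all }u\in\mathcal{V}_n\big(\mathbb{B}^{d_1}\rtimes\mathbb{R}_\Sigma^{d_2},W_{\mu,\boldsymbol\kappa}^{\mathbb{B}\rtimes\Sigma}\big). $$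
   Context: Variables are $(x,y)\in\mathbb{R}^{d_1}\times\mathbb{R}^{d_2}$; $\|x\|$ is the Euclidean norm, $|y|=y_1+\dots+y_{d_2}$ (signed sum), $y=(y',y_{d_2})$ with $y'=(y_1,\dots,y_{d_2-1})$, $|y'|=y_1+\dots+y_{d_2-1}$, and $|\boldsymbol\kappa|=\kappa_1+\dots+\kappa_{d_2-1}$. $\Delta_x$ is the Laplacian in $x$, $\langle x,\nabla_x\rangle=\sum_ix_i\partial_{x_i}$, $\langle y,\nabla_y\rangle=\sum_iy_i\partial_{y_i}$; products of operators mean composition, so $\langle y,\nabla_y\rangle\partial_{y_{d_2}}=\sum_i y_i\partial_{y_i}\partial_{y_{d_2}}$. $\mathbb{R}_\Sigma^{d}=\{y\in\mathbb{R}^d:y_1\ge0,\dots,y_{d-1}\ge0,\ |y|\ge0\}$. The domain is $\mathbb{B}^{d_1}\rtimes\mathbb{R}_\Sigma^{d_2}=\{(x,y)\in\mathbb{R}^{d_1}\times\mathbb{R}_\Sigma^{d_2}:\|x\|\le|y|\}$ with weight $W_{\mu,\boldsymbol\kappa}^{\mathbb{B}\rtimes\Sigma}(x,y)=\big[|y|^2-\|x\|^2\big]^{\mu-\frac12}\prod_{i=1}^{d_2-1}y_i^{\kappa_i}\,e^{-|y'|-|y|}$. For a weight $W$ on $\Omega$, $\mathcal{V}_n(\Omega,W)$ is the space of real polynomials of degree $n$ (together with $0$) orthogonal to all polynomials of degree less than $n$ with respect to $\int_\Omega fg\,W$. *)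

theory Defs
  imports "HOL-Analysis.Analysis"
begin

text \<open>
  The space \<open>\<real>^{d1} \<times> \<real>^{d2}\<close> is \<open>(real^'a) \<times> (real^'b)\<close> with \<open>d1 = CARD('a)\<close> and
  \<open>d2 = CARD('b)\<close>. The coordinates of \<open>y\<close> are ordered, and \<open>last_ix\<close> plays the role of the
  index \<open>d2\<close>; for \<open>CARD('b) = 1\<close> there are no further indices, and the sums and products
  over \<open>UNIV - {last_ix}\<close> below are empty.
\<close>

definition last_ix :: "'b::{finite,linorder}"
  where "last_ix = Max UNIV"

definition ysum :: "real^'b \<Rightarrow> real"
  where "ysum y = (\<Sum>i\<in>UNIV. y $ i)"

definition ysum' :: "real^'b::{finite,linorder} \<Rightarrow> real"
  where "ysum' y = (\<Sum>i\<in>UNIV - {last_ix}. y $ i)"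

text \<open>
  The multi-parameter \<open>\<kappa>\<close> has \<open>d2 - 1\<close> components: only its values on \<open>UNIV - {last_ix}\<close> are used.
  \<open>kappa_ext\<close> implements the convention \<open>\<kappa>_{d2} = 0\<close>.
\<close>

definition kappa_abs :: "('b::{finite,linorder} \<Rightarrow> real) \<Rightarrow> real"
  where "kappa_abs \<kappa> = (\<Sum>i\<in>UNIV - {last_ix}. \<kappa> i)"

definition kappa_ext :: "('b::{finite,linorder} \<Rightarrow> real) \<Rightarrow> 'b \<Rightarrow> real"
  where "kappa_ext \<kappa> = \<kappa>(last_ix := 0)"

definition R_Sigma :: "(real^'b::{finite,linorder}) set"
  where "R_Sigma = {y. (\<forall>i\<in>UNIV - {last_ix}. 0 \<le> y $ i) \<and> 0 \<le> ysum y}"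

definition B_Sigma :: "((real^'a) \<times> (real^'b::{finite,linorder})) set"
  where "B_Sigma = {(x, y). y \<in> R_Sigma \<and> norm x \<le> ysum y}"

text \<open>
  Since \<open>0 powr a = 0\<close>, this weight is set to \<open>0\<close> where a base vanishes. In \<open>B_Sigma\<close> this concerns
  only boundary points, which form a Lebesgue null set.
\<close>

definition W_B_Sigma ::
  "real \<Rightarrow> ('b \<Rightarrow> real) \<Rightarrow> (real^'a) \<times> (real^'b::{finite,linorder}) \<Rightarrow> real"
  where "W_B_Sigma \<mu> \<kappa> = (\<lambda>(x, y).
    ((ysum y)\<^sup>2 - (norm x)\<^sup>2) powr (\<mu> - 1/2)
    * (\<Prod>i\<in>UNIV - {last_ix}. (y $ i) powr \<kappa> i)
    * exp (- ysum' y - ysum y))"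

definition multidegs :: "nat \<Rightarrow> (('a::finite \<Rightarrow> nat) \<times> ('b::finite \<Rightarrow> nat)) set"
  where "multidegs n = {(\<alpha>, \<beta>). (\<Sum>i\<in>UNIV. \<alpha> i) + (\<Sum>i\<in>UNIV. \<beta> i) < n}"

definition monom_fun ::
  "('a \<Rightarrow> nat) \<times> ('b \<Rightarrow> nat) \<Rightarrow> (real^'a) \<times> (real^'b) \<Rightarrow> real"
  where "monom_fun = (\<lambda>(\<alpha>, \<beta>) (x, y). (\<Prod>i\<in>UNIV. (x $ i) ^ \<alpha> i) * (\<Prod>i\<in>UNIV. (y $ i) ^ \<beta> i))"

text \<open>
  Polynomials are identified with polynomial functions on the whole space. \<open>poly_deg_less n\<close>
  contains the zero polynomial for every \<open>n\<close>, and only it for \<open>n = 0\<close>.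
\<close>

definition poly_deg_less :: "nat \<Rightarrow> ((real^'a) \<times> (real^'b) \<Rightarrow> real) set"
  where "poly_deg_less n = {p. \<exists>c. \<forall>z. p z = (\<Sum>m\<in>multidegs n. c m * monom_fun m z)}"

definition poly_deg_eq :: "nat \<Rightarrow> ((real^'a) \<times> (real^'b) \<Rightarrow> real) set"
  where "poly_deg_eq n = poly_deg_less (Suc n) - poly_deg_less n"

definition orth_polys ::
  "((real^'a) \<times> (real^'b)) set \<Rightarrow> ((real^'a) \<times> (real^'b) \<Rightarrow> real) \<Rightarrow> nat
    \<Rightarrow> ((real^'a) \<times> (real^'b) \<Rightarrow> real) set"
  where "orth_polys \<Omega> W n =
    {u \<in> poly_deg_eq n \<union> {\<lambda>_. 0}.
      \<forall>q\<in>poly_deg_less n. (LINT z:\<Omega>|lborel. u z * q z * W z) = 0}"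

definition partial_x ::
  "'a \<Rightarrow> ((real^'a) \<times> (real^'b) \<Rightarrow> real) \<Rightarrow> (real^'a) \<times> (real^'b) \<Rightarrow> real"
  where "partial_x i u = (\<lambda>(x, y). deriv (\<lambda>t. u (x + t *\<^sub>R axis i 1, y)) 0)"

definition partial_y ::
  "'b \<Rightarrow> ((real^'a) \<times> (real^'b) \<Rightarrow> real) \<Rightarrow> (real^'a) \<times> (real^'b) \<Rightarrow> real"
  where "partial_y i u = (\<lambda>(x, y). deriv (\<lambda>t. u (x, y + t *\<^sub>R axis i 1)) 0)"

definition laplace_x ::
  "((real^'a) \<times> (real^'b) \<Rightarrow> real) \<Rightarrow> (real^'a) \<times> (real^'b) \<Rightarrow> real"
  where "laplace_x u z = (\<Sum>i\<in>UNIV. partial_x i (partial_x i u) z)"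

definition euler_x ::
  "((real^'a) \<times> (real^'b) \<Rightarrow> real) \<Rightarrow> (real^'a) \<times> (real^'b) \<Rightarrow> real"
  where "euler_x u z = (\<Sum>i\<in>UNIV. fst z $ i * partial_x i u z)"

definition euler_y ::
  "((real^'a) \<times> (real^'b) \<Rightarrow> real) \<Rightarrow> (real^'a) \<times> (real^'b) \<Rightarrow> real"
  where "euler_y u z = (\<Sum>i\<in>UNIV. snd z $ i * partial_y i u z)"

definition D_B_Sigma ::
  "real \<Rightarrow> ('b \<Rightarrow> real) \<Rightarrow> ((real^'a) \<times> (real^'b::{finite,linorder}) \<Rightarrow> real)
    \<Rightarrow> (real^'a) \<times> (real^'b::{finite,linorder}) \<Rightarrow> real"
  where "D_B_Sigma \<mu> \<kappa> u = (\<lambda>(x, y).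
    ysum y * laplace_x u (x, y)
    + 2 * euler_x (partial_y last_ix u) (x, y)
    - euler_x u (x, y)
    + (\<Sum>i\<in>UNIV. y $ i * partial_y i (partial_y i u) (x, y)
                 + (kappa_ext \<kappa> i + 1 - y $ i) * partial_y i u (x, y))
    + 2 * ysum y * partial_y last_ix (partial_y last_ix u) (x, y)
    - 2 * euler_y (partial_y last_ix u) (x, y)
    + (2 * \<mu> + real CARD('a) - kappa_abs \<kappa> - real CARD('b)) * partial_y last_ix u (x, y))"

text \<open>The sums over \<open>multidegs n\<close> in \<open>poly_deg_less\<close> are genuine finite sums.\<close>

lemma finite_multidegs:
  "finite (multidegs n :: (('a::finite \<Rightarrow> nat) \<times> ('b::finite \<Rightarrow> nat)) set)"
proof (rule finite_subset)
  have le: "f i \<le> (\<Sum>j\<in>UNIV. f j)" for f :: "'c::finite \<Rightarrow> nat" and i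
    by (rule member_le_sum) auto
  show "(multidegs n :: (('a \<Rightarrow> nat) \<times> ('b \<Rightarrow> nat)) set)
      \<subseteq> (UNIV \<rightarrow>\<^sub>E {..<n}) \<times> (UNIV \<rightarrow>\<^sub>E {..<n})"
    using le order_le_less_trans[OF trans_le_add1[OF le]] order_le_less_trans[OF trans_le_add2[OF le]]
    by (auto simp: multidegs_def PiE_UNIV_domain)
  show "finite (((UNIV::'a set) \<rightarrow>\<^sub>E {..<n}) \<times> ((UNIV::'b set) \<rightarrow>\<^sub>E {..<n}))"
    by (intro finite_cartesian_product finite_PiE) auto
qed

end

theory Submission
  imports Defs
begin

text \<open>
  Write \<open>t = |y|\<close> and use \<open>(x, y', t)\<close> as coordinates. The domain becomes the product of an
  orthant in \<open>y'\<close> and the solid cone \<open>\<parallel>x\<parallel> \<le> t\<close>, the weight becomes a product of Laguerre weights in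
  \<open>y'\<close> and the weight \<open>(t\<^sup>2 - \<parallel>x\<parallel>\<^sup>2)\<^sup>a e\<^sup>-\<^sup>t\<close> with \<open>a = \<mu> - 1/2\<close>, and the operator becomes the divergence
  form operator \<open>u \<mapsto> W\<^sup>-\<^sup>1 div (W A \<nabla>u)\<close> (lemma \<open>D_B_Sigma_divergence_form\<close>), where the symmetric
  matrix \<open>A\<close> has linear entries: its rows are the vector fields \<open>boost i\<close> (for \<open>x\<^sub>i\<close>), \<open>dilation\<close>
  (for \<open>t\<close>) and \<open>stretch j\<close> (for \<open>y\<^sub>j\<close>).

  Symmetry of the operator follows once the integral of \<open>W\<^sup>-\<^sup>1 div (W g V)\<close> against \<open>W\<close> vanishes for
  every polynomial \<open>g\<close> and each of these fields \<open>V\<close>. The weight is singular on the boundary when its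
  exponents are negative, so that no boundary term can be evaluated there. But \<open>V\<close> generates a linear
  flow that maps the domain onto itself: a hyperbolic rotation of \<open>(x\<^sub>i, t)\<close>, a dilation of \<open>(x, t)\<close>,
  or a dilation of \<open>y\<^sub>j\<close>. Without its exponential factor the weight is preserved by the flow up to a
  scalar factor. The integral in question is the derivative, along the flow, of an integral that the
  change of variables formula shows to be constant (lemma \<open>integral_along_flow_zero\<close>).

  On polynomials of degree \<open>n\<close> the operator acts as minus the Euler operator, hence as \<open>-n\<close>, up to
  terms of smaller degree (lemma \<open>D_B_Sigma_lowers_degree\<close>). So for \<open>u\<close> in the \<open>n\<close>-th orthogonal space
  the polynomial \<open>f = D u + n u\<close> has degree less than \<open>n\<close>. By symmetry
  \<open>\<langle>f, f\<rangle> = \<langle>u, D f\<rangle> + n \<langle>u, f\<rangle>\<close>, and both terms vanish because \<open>D f\<close> and \<open>f\<close> have degree less than \<open>n\<close>.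
  The weight is positive on a nonempty open set, and therefore \<open>f = 0\<close>.
\<close>

section \<open>Directional derivatives of polynomial functions\<close>

lemmas real_polynomial_linear = real_polynomial_function.intros(1)
lemmas real_polynomial_const = real_polynomial_function.intros(2)
lemmas real_polynomial_add = real_polynomial_function.intros(3)
lemmas real_polynomial_mult = real_polynomial_function.intros(4)

definition dir_deriv :: "'e::real_normed_vector \<Rightarrow> ('e \<Rightarrow> real) \<Rightarrow> 'e \<Rightarrow> real"
  where "dir_deriv v p z = frechet_derivative p (at z) v"

lemma dir_deriv_eq:
  assumes "(p has_derivative p') (at z)"
  shows "dir_deriv v p z = p' v"
  unfolding dir_deriv_def using frechet_derivative_at[OF assms] by simp

lemma has_derivative_dir_deriv:
  fixes p :: "'e::euclidean_space \<Rightarrow> real"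
  assumes "real_polynomial_function p"
  shows "(p has_derivative (\<lambda>v. dir_deriv v p z)) (at z)"
  using differentiable_at_real_polynomial_function[OF assms, of z UNIV]
  unfolding dir_deriv_def frechet_derivative_works by simp

lemma dir_deriv_linear: "bounded_linear l \<Longrightarrow> dir_deriv v l z = l v"
  by (rule dir_deriv_eq) (rule bounded_linear_imp_has_derivative)

lemma dir_deriv_const: "dir_deriv v (\<lambda>_. c) z = 0"
  by (rule dir_deriv_eq) simp

lemma dir_deriv_add:
  fixes p :: "'e::euclidean_space \<Rightarrow> real"
  assumes "real_polynomial_function p" "real_polynomial_function q"
  shows "dir_deriv v (\<lambda>z. p z + q z) z = dir_deriv v p z + dir_deriv v q z"
  by (rule dir_deriv_eq)
     (intro has_derivative_add has_derivative_dir_deriv assms)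

lemma dir_deriv_mult:
  fixes p :: "'e::euclidean_space \<Rightarrow> real"
  assumes "real_polynomial_function p" "real_polynomial_function q"
  shows "dir_deriv v (\<lambda>z. p z * q z) z = p z * dir_deriv v q z + dir_deriv v p z * q z"
  by (rule dir_deriv_eq)
     (intro has_derivative_mult has_derivative_dir_deriv assms)

lemma dir_deriv_diff:
  fixes p :: "'e::euclidean_space \<Rightarrow> real"
  assumes "real_polynomial_function p" "real_polynomial_function q"
  shows "dir_deriv v (\<lambda>z. p z - q z) z = dir_deriv v p z - dir_deriv v q z"
  by (rule dir_deriv_eq)
     (intro has_derivative_diff has_derivative_dir_deriv assms)

lemma linear_dir_deriv:
  fixes p :: "'e::euclidean_space \<Rightarrow> real"
  assumes "real_polynomial_function p"
  shows "linear (\<lambda>v. dir_deriv v p z)"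
  using has_derivative_dir_deriv[OF assms] has_derivative_linear by blast

text \<open>
  The direction may depend on the point: the formula then shows that a derivative along a linear
  vector field is again a polynomial.
\<close>

lemma dir_deriv_vector_field:
  fixes p :: "'e::euclidean_space \<Rightarrow> real"
  assumes "real_polynomial_function p"
  shows "dir_deriv v p z = (\<Sum>b\<in>Basis. (v \<bullet> b) * dir_deriv b p z)"
proof -
  have "dir_deriv v p z = dir_deriv (\<Sum>b\<in>Basis. (v \<bullet> b) *\<^sub>R b) p z"
    by (simp add: euclidean_representation)
  also have "\<dots> = (\<Sum>b\<in>Basis. (v \<bullet> b) * dir_deriv b p z)"
    by (simp add: linear_sum[OF linear_dir_deriv[OF assms]]
        linear_cmul[OF linear_dir_deriv[OF assms]])
  finally show ?thesis .
qed

lemma real_polynomial_function_dir_deriv: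
  fixes p :: "'e::euclidean_space \<Rightarrow> real"
  assumes "real_polynomial_function p"
  shows "real_polynomial_function (dir_deriv v p)"
  using assms
proof induction
  case (linear f)
  then show ?case
    by (metis dir_deriv_linear ext real_polynomial_const)
next
  case (const c)
  then show ?case
    by (simp add: dir_deriv_const[abs_def] real_polynomial_const)
next
  case (add f g)
  moreover have "dir_deriv v (\<lambda>x. f x + g x) = (\<lambda>z. dir_deriv v f z + dir_deriv v g z)"
    using dir_deriv_add add.hyps by blast
  ultimately show ?case by (simp add: real_polynomial_add)
next
  case (mult f g)
  moreover have "dir_deriv v (\<lambda>x. f x * g x) = (\<lambda>z. f z * dir_deriv v g z + dir_deriv v f z * g z)"
    using dir_deriv_mult mult.hyps by blast
  ultimately show ?case
    by (simp add: real_polynomial_add real_polynomial_mult)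
qed

lemma real_polynomial_function_dir_deriv_field:
  fixes p :: "'e::euclidean_space \<Rightarrow> real"
  assumes p: "real_polynomial_function p" and A: "linear A"
  shows "real_polynomial_function (\<lambda>z. dir_deriv (A z) p z)"
proof -
  have "bounded_linear (\<lambda>z. A z \<bullet> b)" for b
    using A by (simp add: bounded_linear_compose[OF bounded_linear_inner_left] linear_conv_bounded_linear)
  then show ?thesis
    unfolding dir_deriv_vector_field[OF p, of "A _"]
    by (intro real_polynomial_function_sum real_polynomial_mult
        real_polynomial_linear real_polynomial_function_dir_deriv p) auto
qed

lemma dir_deriv_commute:
  fixes p :: "'e::euclidean_space \<Rightarrow> real"
  assumes "real_polynomial_function p"
  shows "dir_deriv v (dir_deriv w p) z = dir_deriv w (dir_deriv v p) z"
  using assms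
proof (induction arbitrary: z)
  case (linear f)
  then have "dir_deriv u f = (\<lambda>_. f u)" for u
    using dir_deriv_linear by blast
  then show ?case by (simp add: dir_deriv_const)
next
  case (const c)
  then show ?case by (simp add: dir_deriv_const[abs_def])
next
  case (add f g)
  have "dir_deriv u (\<lambda>x. f x + g x) = (\<lambda>z. dir_deriv u f z + dir_deriv u g z)" for u
    using dir_deriv_add add.hyps by blast
  with add show ?case
    by (simp add: dir_deriv_add real_polynomial_function_dir_deriv)
next
  case (mult f g)
  have "dir_deriv u (\<lambda>x. f x * g x) = (\<lambda>z. f z * dir_deriv u g z + dir_deriv u f z * g z)" for u
    using dir_deriv_mult mult.hyps by blast
  with mult show ?case
    by (simp add: dir_deriv_add dir_deriv_mult real_polynomial_function_dir_deriv
        real_polynomial_mult)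
qed

lemma deriv_along_line:
  fixes p :: "'e::euclidean_space \<Rightarrow> real"
  assumes p: "real_polynomial_function p"
  shows "deriv (\<lambda>t. p (z + t *\<^sub>R v)) 0 = dir_deriv v p z"
proof -
  have line: "((\<lambda>t. z + t *\<^sub>R v) has_derivative (\<lambda>t. t *\<^sub>R v)) (at 0)"
    by (auto intro!: derivative_eq_intros)
  have "((\<lambda>t. p (z + t *\<^sub>R v)) has_derivative (\<lambda>t. dir_deriv (t *\<^sub>R v) p z)) (at 0)"
    using has_derivative_compose[OF line has_derivative_dir_deriv[OF p]] by simp
  then have "((\<lambda>t. p (z + t *\<^sub>R v)) has_derivative (\<lambda>t. dir_deriv v p z * t)) (at 0)"
    unfolding linear_cmul[OF linear_dir_deriv[OF p]] by (simp add: mult.commute)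
  then show ?thesis by (intro DERIV_imp_deriv) (simp add: has_field_derivative_def)
qed

text \<open>
  A bound by an exponential of arbitrarily small rate is stable under products (each factor takes half
  of the rate), so no degree has to be recorded; it suffices because all weights decay exponentially.
\<close>

lemma real_polynomial_growth:
  fixes p :: "'e::euclidean_space \<Rightarrow> real"
  assumes "real_polynomial_function p" "\<epsilon> > 0"
  shows "\<exists>C\<ge>0. \<forall>z. \<bar>p z\<bar> \<le> C * exp (\<epsilon> * norm z)"
  using assms
proof (induction arbitrary: \<epsilon>)
  case (linear f)
  then obtain K where K: "K \<ge> 0" "\<And>z. norm (f z) \<le> norm z * K"
    using bounded_linear.nonneg_bounded by blast
  have "\<bar>f z\<bar> \<le> K / \<epsilon> * exp (\<epsilon> * norm z)" for z
  proof -
    have "\<epsilon> * norm z \<le> exp (\<epsilon> * norm z)"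
      using exp_ge_add_one_self[of "\<epsilon> * norm z"] by linarith
    then have "K / \<epsilon> * (\<epsilon> * norm z) \<le> K / \<epsilon> * exp (\<epsilon> * norm z)"
      using K linear by (intro mult_left_mono) auto
    with K(2)[of z] linear(2) show ?thesis by (simp add: mult.commute)
  qed
  then show ?case using K linear by (intro exI[of _ "K / \<epsilon>"]) auto
next
  case (const c)
  have "\<bar>c\<bar> * 1 \<le> \<bar>c\<bar> * exp (\<epsilon> * norm (z::'e))" for z
    using const by (intro mult_left_mono) auto
  then show ?case by (intro exI[of _ "\<bar>c\<bar>"]) auto
next
  case (add f g)
  then obtain C D where "C \<ge> 0" "\<forall>z. \<bar>f z\<bar> \<le> C * exp (\<epsilon> * norm z)"
    "D \<ge> 0" "\<forall>z. \<bar>g z\<bar> \<le> D * exp (\<epsilon> * norm z)" by meson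
  then show ?case
    by (intro exI[of _ "C + D"])
       (auto simp: distrib_right intro: order_trans[OF abs_triangle_ineq] add_mono)
next
  case (mult f g)
  then obtain C D where CD: "C \<ge> 0" "\<forall>z. \<bar>f z\<bar> \<le> C * exp (\<epsilon>/2 * norm z)"
    "D \<ge> 0" "\<forall>z. \<bar>g z\<bar> \<le> D * exp (\<epsilon>/2 * norm z)"
    by (meson half_gt_zero)
  have "\<bar>f z * g z\<bar> \<le> (C * exp (\<epsilon>/2 * norm z)) * (D * exp (\<epsilon>/2 * norm z))" for z
    unfolding abs_mult using CD by (intro mult_mono) auto
  also have "(C * exp (\<epsilon>/2 * norm z)) * (D * exp (\<epsilon>/2 * norm z)) = C * D * exp (\<epsilon> * norm z)" for z :: 'e
  proof -
    have "exp (\<epsilon>/2 * norm z) * exp (\<epsilon>/2 * norm z) = exp (\<epsilon> * norm z)"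
      by (simp flip: exp_add)
    then show ?thesis by (metis (no_types, lifting) mult.assoc mult.left_commute)
  qed
  finally show ?case using CD by (intro exI[of _ "C * D"]) auto
qed

lemma real_polynomial_zero_if_zero_on_open:
  fixes p :: "'e::euclidean_space \<Rightarrow> real"
  assumes p: "real_polynomial_function p" and U: "open U" "U \<noteq> {}" and 0: "\<And>z. z \<in> U \<Longrightarrow> p z = 0"
  shows "p z = 0"
proof -
  obtain z0 where z0: "z0 \<in> U" using U by blast
  \<comment> \<open>On the line from a point of the open set to z, the polynomial has infinitely many roots.\<close>
  define L where "L s = z0 + s *\<^sub>R (z - z0)" for s :: real
  have L: "polynomial_function L"
    unfolding L_def by (intro polynomial_function_add polynomial_function_const polynomial_function_mult polynomial_function_id)
  have "real_polynomial_function (p \<circ> L)"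
    using real_polynomial_function_compose[OF L p] .
  then obtain a m where am: "p \<circ> L = (\<lambda>x. \<Sum>i\<le>m. a i * x ^ i)"
    using real_polynomial_function_imp_sum by metis
  have cont: "continuous (at 0) L"
    unfolding L_def by (intro continuous_intros)
  have "L 0 \<in> U" using z0 by (simp add: L_def)
  with cont U(1) have "eventually (\<lambda>s. L s \<in> U) (at 0)"
    by (metis continuous_within topological_tendstoD)
  then obtain d where d: "d > 0" "\<And>s. s \<noteq> 0 \<Longrightarrow> dist s 0 < d \<Longrightarrow> L s \<in> U"
    unfolding eventually_at by auto
  have "{0<..<d} \<subseteq> {x. (\<Sum>i\<le>m. a i * x ^ i) = 0}"
  proof
    fix s assume "s \<in> {0<..<d}"
    then have "p (L s) = 0" using 0 d by simp
    then show "s \<in> {x. (\<Sum>i\<le>m. a i * x ^ i) = 0}"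
      using am by (simp add: fun_eq_iff)
  qed
  moreover have "infinite {0<..<d}" using d by simp
  ultimately have "infinite {x. (\<Sum>i\<le>m. a i * x ^ i) = 0}"
    using finite_subset by blast
  then have "\<forall>i\<le>m. a i = 0" using polyfun_finite_roots[of a m] by blast
  then have "(p \<circ> L) 1 = 0" using am by simp
  then show ?thesis by (simp add: L_def)
qed

lemma real_polynomial_borel:
  fixes p :: "'e::euclidean_space \<Rightarrow> real"
  shows "real_polynomial_function p \<Longrightarrow> p \<in> borel_measurable borel"
  by (intro borel_measurable_continuous_onI continuous_on_polymonial_function)
     (simp add: real_polynomial_function_eq)

section \<open>Polynomials of bounded degree\<close>

text \<open>
  Polynomials of degree less than \<open>k\<close> on any Euclidean space. With products by linear forms as the
  generating step, statements about derivations become inductions by the Leibniz rule, and no basis of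
  monomials is involved.
\<close>

inductive poly_below :: "nat \<Rightarrow> ('e::euclidean_space \<Rightarrow> real) \<Rightarrow> bool" where
  zero: "poly_below k (\<lambda>_. 0)"
| const: "poly_below (Suc k) (\<lambda>_. c)"
| add: "poly_below k p \<Longrightarrow> poly_below k q \<Longrightarrow> poly_below k (\<lambda>z. p z + q z)"
| mult: "poly_below k p \<Longrightarrow> bounded_linear l \<Longrightarrow> poly_below (Suc k) (\<lambda>z. l z * p z)"

lemma poly_below_imp_real_polynomial:
  "poly_below k p \<Longrightarrow> real_polynomial_function p"
  by (induction rule: poly_below.induct) (auto intro: real_polynomial_function.intros)

lemma poly_below_0: "poly_below 0 p \<Longrightarrow> p = (\<lambda>_. 0)"
  by (induction "0::nat" p rule: poly_below.induct) auto

lemma poly_below_Suc: "poly_below k p \<Longrightarrow> poly_below (Suc k) p"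
  by (induction rule: poly_below.induct) (auto intro: poly_below.intros)

lemma poly_below_mono: "poly_below j p \<Longrightarrow> j \<le> k \<Longrightarrow> poly_below k p"
  by (induction k) (auto simp: le_Suc_eq intro: poly_below_Suc)

lemma poly_below_cmult: "poly_below k p \<Longrightarrow> poly_below k (\<lambda>z. c * p z)"
proof (induction rule: poly_below.induct)
  case (mult k p l)
  then have "poly_below (Suc k) (\<lambda>z. l z * (c * p z))" by (intro poly_below.mult)
  then show ?case by (simp add: mult_ac)
qed (auto simp: distrib_left intro: poly_below.intros)

lemma poly_below_diff:
  assumes "poly_below k p" "poly_below k q"
  shows "poly_below k (\<lambda>z. p z - q z)"
  using poly_below.add[OF assms(1) poly_below_cmult[OF assms(2), of "-1"]] by simp

lemma poly_below_sum:
  "(\<And>i. i \<in> I \<Longrightarrow> poly_below k (p i)) \<Longrightarrow> poly_below k (\<lambda>z. \<Sum>i\<in>I. p i z)"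
  by (induction I rule: infinite_finite_induct) (auto intro: poly_below.intros)

lemma poly_below_dir_deriv: "poly_below k p \<Longrightarrow> poly_below (k - 1) (dir_deriv v p)"
proof (induction rule: poly_below.induct)
  case (add k p q)
  have "dir_deriv v (\<lambda>x. p x + q x) = (\<lambda>z. dir_deriv v p z + dir_deriv v q z)"
    using dir_deriv_add add.hyps poly_below_imp_real_polynomial by blast
  with add show ?case by (auto intro: poly_below.add)
next
  case (mult k p l)
  have eq: "dir_deriv v (\<lambda>z. l z * p z) = (\<lambda>z. l z * dir_deriv v p z + l v * p z)"
    using dir_deriv_mult[OF real_polynomial_linear[OF mult.hyps(2)]
        poly_below_imp_real_polynomial[OF mult.hyps(1)]] mult.hyps(2)
    by (auto simp: dir_deriv_linear)
  show ?case
  proof (cases k)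
    case 0
    then have "p = (\<lambda>_. 0)" using mult poly_below_0 by blast
    then show ?thesis by (simp add: dir_deriv_const[abs_def] poly_below.zero)
  next
    case (Suc j)
    then show ?thesis unfolding eq using mult
      by (auto intro!: poly_below.add poly_below_cmult poly_below.mult)
  qed
qed (auto simp: dir_deriv_const[abs_def] intro: poly_below.intros)

lemma poly_below_dir_deriv_mult:
  assumes "poly_below k p" "bounded_linear l"
  shows "poly_below k (\<lambda>z. l z * dir_deriv v p z)"
proof (cases k)
  case 0
  then have "p = (\<lambda>_. 0)" using assms poly_below_0 by blast
  then show ?thesis by (simp add: dir_deriv_const[abs_def] poly_below.zero)
next
  case (Suc j)
  then show ?thesis
    using poly_below.mult[OF poly_below_dir_deriv[OF assms(1)] assms(2), of v] by simp
qed

text \<open>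
  Euler's identity up to lower order: passing from \<open>p\<close> to \<open>l p\<close> adds \<open>l p\<close> to the radial derivative
  and one to the degree bound.
\<close>

lemma poly_below_euler:
  "poly_below k p \<Longrightarrow> poly_below (k - 1) (\<lambda>z. real (k - 1) * p z - dir_deriv z p z)"
proof (induction rule: poly_below.induct)
  case (zero k)
  then show ?case by (simp add: dir_deriv_const poly_below.zero)
next
  case (const k c)
  then show ?case
    by (cases k) (auto simp: dir_deriv_const intro: poly_below.intros)
next
  case (add k p q)
  have "dir_deriv z (\<lambda>x. p x + q x) z = dir_deriv z p z + dir_deriv z q z" for z
    using dir_deriv_add add.hyps poly_below_imp_real_polynomial by blast
  with poly_below.add[OF add.IH] show ?case by (simp add: algebra_simps)
next
  case (mult k p l)
  have eq: "dir_deriv z (\<lambda>z. l z * p z) z = l z * dir_deriv z p z + l z * p z" for z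
    using dir_deriv_mult[OF real_polynomial_linear[OF mult.hyps(2)]
        poly_below_imp_real_polynomial[OF mult.hyps(1)]] mult.hyps(2)
    by (auto simp: dir_deriv_linear)
  show ?case
  proof (cases k)
    case 0
    then have "p = (\<lambda>_. 0)" using mult poly_below_0 by blast
    then show ?thesis by (simp add: dir_deriv_const poly_below.zero)
  next
    case (Suc j)
    then have "poly_below k (\<lambda>z. l z * (real j * p z - dir_deriv z p z))"
      using poly_below.mult[OF mult.IH mult.hyps(2)] by simp
    then show ?thesis unfolding eq using Suc
      by (simp add: algebra_simps)
  qed
qed

text \<open>
  Each monomial is built by multiplying with one coordinate of positive exponent at a time.
\<close>

lemma monom_fun_poly_below:
  "(\<alpha>, \<beta>) \<in> multidegs k \<Longrightarrow> poly_below k (monom_fun (\<alpha>, \<beta>) :: (real^'a) \<times> (real^'b) \<Rightarrow> real)"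
proof (induction k arbitrary: \<alpha> \<beta>)
  case 0
  then show ?case by (simp add: multidegs_def)
next
  case (Suc k)
  consider (a) i where "\<alpha> i > 0" | (b) i where "\<beta> i > 0" | (c) "\<And>i. \<alpha> i = 0" "\<And>i. \<beta> i = 0"
    by auto
  then show ?case
  proof cases
    case a
    let ?\<alpha> = "\<alpha>(i := \<alpha> i - 1)"
    have s: "(\<Sum>j\<in>UNIV. \<alpha> j) = Suc (\<Sum>j\<in>UNIV. ?\<alpha> j)"
      using a by (simp add: sum.remove[of UNIV i])
    have "poly_below (Suc k) (\<lambda>z. fst z $ i * monom_fun (?\<alpha>, \<beta>) z :: real)"
      using Suc s by (intro poly_below.mult Suc.IH)
        (auto simp: multidegs_def intro!: bounded_linear_compose[OF bounded_linear_vec_nth] bounded_linear_fst)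
    moreover have "fst z $ i * monom_fun (?\<alpha>, \<beta>) z = monom_fun (\<alpha>, \<beta>) z" for z :: "(real^'a) \<times> (real^'b)"
    proof -
      have "fst z $ i * (\<Prod>j\<in>UNIV. (fst z $ j) ^ ?\<alpha> j) = (\<Prod>j\<in>UNIV. (fst z $ j) ^ \<alpha> j)"
        using a by (simp add: prod.remove[of UNIV i] mult.assoc[symmetric] power_Suc[symmetric] del: power_Suc)
      then show ?thesis by (simp add: monom_fun_def case_prod_beta mult.assoc[symmetric])
    qed
    ultimately show ?thesis by simp
  next
    case b
    let ?\<beta> = "\<beta>(i := \<beta> i - 1)"
    have s: "(\<Sum>j\<in>UNIV. \<beta> j) = Suc (\<Sum>j\<in>UNIV. ?\<beta> j)"
      using b by (simp add: sum.remove[of UNIV i])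
    have "poly_below (Suc k) (\<lambda>z. snd z $ i * monom_fun (\<alpha>, ?\<beta>) z :: real)"
      using Suc s by (intro poly_below.mult Suc.IH)
        (auto simp: multidegs_def intro!: bounded_linear_compose[OF bounded_linear_vec_nth] bounded_linear_snd)
    moreover have "snd z $ i * monom_fun (\<alpha>, ?\<beta>) z = monom_fun (\<alpha>, \<beta>) z" for z :: "(real^'a) \<times> (real^'b)"
    proof -
      have "snd z $ i * (\<Prod>j\<in>UNIV. (snd z $ j) ^ ?\<beta> j) = (\<Prod>j\<in>UNIV. (snd z $ j) ^ \<beta> j)"
        using b by (simp add: prod.remove[of UNIV i] mult.assoc[symmetric] power_Suc[symmetric] del: power_Suc)
      then show ?thesis by (simp add: monom_fun_def case_prod_beta mult.left_commute)
    qed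
    ultimately show ?thesis by simp
  next
    case c
    then have "monom_fun (\<alpha>, \<beta>) = (\<lambda>z :: (real^'a) \<times> (real^'b). 1)"
      by (auto simp: monom_fun_def)
    then show ?thesis by (simp add: poly_below.const)
  qed
qed

lemma poly_deg_less_add:
  assumes "p \<in> poly_deg_less k" "q \<in> poly_deg_less k"
  shows "(\<lambda>z. p z + q z) \<in> poly_deg_less k"
proof -
  from assms obtain c d where "\<forall>z. p z = (\<Sum>m\<in>multidegs k. c m * monom_fun m z)"
    "\<forall>z. q z = (\<Sum>m\<in>multidegs k. d m * monom_fun m z)"
    unfolding poly_deg_less_def by blast
  then show ?thesis unfolding poly_deg_less_def
    by (intro CollectI exI[of _ "\<lambda>m. c m + d m"]) (simp add: sum.distrib distrib_right)
qed

lemma poly_deg_less_cmult: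
  assumes "p \<in> poly_deg_less k"
  shows "(\<lambda>z. c * p z) \<in> poly_deg_less k"
proof -
  from assms obtain d where "\<forall>z. p z = (\<Sum>m\<in>multidegs k. d m * monom_fun m z)"
    unfolding poly_deg_less_def by blast
  then show ?thesis unfolding poly_deg_less_def
    by (intro CollectI exI[of _ "\<lambda>m. c * d m"]) (simp add: sum_distrib_left mult.assoc)
qed

lemma poly_deg_less_0: "(\<lambda>_. 0) \<in> poly_deg_less k"
  unfolding poly_deg_less_def by (intro CollectI exI[of _ "\<lambda>_. 0"]) simp

lemma poly_deg_less_sum:
  "(\<And>i. i \<in> I \<Longrightarrow> p i \<in> poly_deg_less k) \<Longrightarrow> (\<lambda>z. \<Sum>i\<in>I. p i z) \<in> poly_deg_less k"
  by (induction I rule: infinite_finite_induct) (auto intro: poly_deg_less_0 poly_deg_less_add)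

lemma monom_fun_poly_deg_less:
  fixes m :: "('a::finite \<Rightarrow> nat) \<times> ('b::finite \<Rightarrow> nat)"
  assumes "m \<in> multidegs k"
  shows "monom_fun m \<in> poly_deg_less k"
  unfolding poly_deg_less_def using assms
  by (intro CollectI exI[of _ "\<lambda>m'. if m' = m then 1 else 0"])
     (simp add: if_distrib[of "\<lambda>x. x * _"] finite_multidegs cong: if_cong)

lemma poly_deg_less_mult_coordinate:
  fixes p :: "(real^'a) \<times> (real^'b) \<Rightarrow> real"
  assumes p: "p \<in> poly_deg_less k" and b: "b \<in> Basis"
  shows "(\<lambda>z. (z \<bullet> b) * p z) \<in> poly_deg_less (Suc k)"
proof -
  have mon: "(\<lambda>z. (z \<bullet> b) * monom_fun m z) \<in> poly_deg_less (Suc k)" if "m \<in> multidegs k"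
    for m :: "('a \<Rightarrow> nat) \<times> ('b \<Rightarrow> nat)"
  proof -
    obtain \<alpha> \<beta> where m: "m = (\<alpha>, \<beta>)" by (cases m)
    from b consider i where "b = (axis i 1, 0)" | i where "b = (0, axis i 1)"
      by (auto simp: Basis_prod_def Basis_vec_def)
    then show ?thesis
    proof cases
      case 1
      let ?\<alpha> = "\<alpha>(i := Suc (\<alpha> i))"
      have "(z \<bullet> b) * monom_fun m z = monom_fun (?\<alpha>, \<beta>) z" for z
        by (simp add: 1 m monom_fun_def case_prod_beta inner_prod_def inner_axis prod.remove[of UNIV i])
      moreover have "(\<Sum>j\<in>UNIV. ?\<alpha> j) = Suc (\<Sum>j\<in>UNIV. \<alpha> j)"
        by (simp add: sum.remove[of UNIV i])
      ultimately show ?thesis using monom_fun_poly_deg_less[of "(?\<alpha>, \<beta>)" "Suc k"] that m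
        by (simp add: multidegs_def)
    next
      case 2
      let ?\<beta> = "\<beta>(i := Suc (\<beta> i))"
      have "(z \<bullet> b) * monom_fun m z = monom_fun (\<alpha>, ?\<beta>) z" for z
        by (simp add: 2 m monom_fun_def case_prod_beta inner_prod_def inner_axis prod.remove[of UNIV i])
      moreover have "(\<Sum>j\<in>UNIV. ?\<beta> j) = Suc (\<Sum>j\<in>UNIV. \<beta> j)"
        by (simp add: sum.remove[of UNIV i])
      ultimately show ?thesis using monom_fun_poly_deg_less[of "(\<alpha>, ?\<beta>)" "Suc k"] that m
        by (simp add: multidegs_def)
    qed
  qed
  from p obtain c where "\<forall>z. p z = (\<Sum>m\<in>multidegs k. c m * monom_fun m z)"
    unfolding poly_deg_less_def by blast
  then have "(\<lambda>z. (z \<bullet> b) * p z) = (\<lambda>z. \<Sum>m\<in>multidegs k. c m * ((z \<bullet> b) * monom_fun m z))"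
    by (simp add: fun_eq_iff sum_distrib_left mult_ac del: split_paired_All)
  then show ?thesis by (simp add: poly_deg_less_sum poly_deg_less_cmult mon)
qed

lemma poly_deg_less_iff_poly_below:
  fixes p :: "(real^'a) \<times> (real^'b) \<Rightarrow> real"
  shows "p \<in> poly_deg_less k \<longleftrightarrow> poly_below k p"
proof
  assume "p \<in> poly_deg_less k"
  then obtain c where "\<forall>z. p z = (\<Sum>m\<in>multidegs k. c m * monom_fun m z)"
    unfolding poly_deg_less_def by blast
  then have "p = (\<lambda>z. \<Sum>m\<in>multidegs k. c m * monom_fun m z)" by auto
  then show "poly_below k p"
    using monom_fun_poly_below by (auto intro!: poly_below_sum poly_below_cmult)
next
  assume "poly_below k p"
  then show "p \<in> poly_deg_less k"
  proof induction
    case (const k c)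
    have "(\<lambda>_. 0, \<lambda>_. 0) \<in> (multidegs (Suc k) :: (('a \<Rightarrow> nat) \<times> ('b \<Rightarrow> nat)) set)"
      by (simp add: multidegs_def)
    from poly_deg_less_cmult[OF monom_fun_poly_deg_less[OF this], of c]
    show ?case by (simp add: monom_fun_def case_prod_beta)
  next
    case (mult k p l)
    have l: "l z = (\<Sum>b\<in>Basis. l b * (z \<bullet> b))" for z
    proof -
      have "l z = l (\<Sum>b\<in>Basis. (z \<bullet> b) *\<^sub>R b)" by (simp add: euclidean_representation)
      then show ?thesis using bounded_linear.linear[OF mult.hyps(2)]
        by (simp add: linear_sum linear_cmul mult.commute)
    qed
    have "l z * p z = (\<Sum>b\<in>Basis. l b * ((z \<bullet> b) * p z))" for z
      by (subst l) (simp add: sum_distrib_right mult.assoc)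
    then have "(\<lambda>z. l z * p z) = (\<lambda>z. \<Sum>b\<in>Basis. l b * ((z \<bullet> b) * p z))"
      by blast
    with mult.IH show ?case
      by (simp add: poly_deg_less_sum poly_deg_less_cmult poly_deg_less_mult_coordinate)
  qed (auto intro: poly_deg_less_0 poly_deg_less_add)
qed

section \<open>Lebesgue measure under shears and diagonal maps\<close>

text \<open>
  Integrating over the coordinate \<open>e\<close> first, the shear is a translation of that coordinate by a number
  that depends on the other coordinates only. The shear may be nonlinear: the integrability of the
  weight comes from a shear by a norm.
\<close>

lemma nn_integral_shear:
  fixes e :: "'e::euclidean_space"
  assumes e: "e \<in> Basis"
    and \<phi>[measurable]: "\<phi> \<in> borel_measurable borel"
    and inv: "\<And>z s. \<phi> (z + s *\<^sub>R e) = \<phi> z"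
    and f[measurable]: "f \<in> borel_measurable borel"
  shows "(\<integral>\<^sup>+z. f (z + \<phi> z *\<^sub>R e) \<partial>lborel) = (\<integral>\<^sup>+z. f z \<partial>lborel)"
proof -
  interpret product_sigma_finite "\<lambda>_::'e. lborel :: real measure" ..
  let ?J = "Basis - {e}"
  let ?V = "\<lambda>x. (\<Sum>b\<in>?J. x b *\<^sub>R b)"
  have B: "Basis = insert e ?J" using e by auto
  have split: "(\<Sum>b\<in>Basis. (x(e := y)) b *\<^sub>R b) = ?V x + y *\<^sub>R e" for x and y :: real
    by (simp add: sum.remove[OF finite_Basis e] add.commute)
  have fubini: "(\<integral>\<^sup>+z. g z \<partial>lborel) = (\<integral>\<^sup>+x. (\<integral>\<^sup>+y. g (?V x + y *\<^sub>R e) \<partial>lborel) \<partial>(\<Pi>\<^sub>M b\<in>?J. lborel))"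
    if [measurable]: "g \<in> borel_measurable borel" for g :: "'e \<Rightarrow> ennreal"
  proof -
    have "(\<integral>\<^sup>+z. g z \<partial>lborel) = (\<integral>\<^sup>+x. g (\<Sum>b\<in>Basis. x b *\<^sub>R b) \<partial>(\<Pi>\<^sub>M b\<in>Basis. lborel))"
      by (subst lborel_eq) (simp add: nn_integral_distr)
    also have "\<dots> = (\<integral>\<^sup>+x. g (\<Sum>b\<in>Basis. x b *\<^sub>R b) \<partial>(\<Pi>\<^sub>M b\<in>insert e ?J. lborel))"
      using B by simp
    also have "\<dots> = (\<integral>\<^sup>+x. (\<integral>\<^sup>+y. g (\<Sum>b\<in>Basis. (x(e := y)) b *\<^sub>R b) \<partial>lborel) \<partial>(\<Pi>\<^sub>M b\<in>?J. lborel))"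
      by (rule product_nn_integral_insert) (use B in \<open>auto simp flip: B\<close>)
    finally show ?thesis by (simp only: split)
  qed
  have "(\<integral>\<^sup>+y. f (?V x + y *\<^sub>R e + \<phi> (?V x + y *\<^sub>R e) *\<^sub>R e) \<partial>lborel)
      = (\<integral>\<^sup>+y. f (?V x + y *\<^sub>R e) \<partial>lborel)" for x :: "'e \<Rightarrow> real"
  proof -
    have "(\<integral>\<^sup>+y. f (?V x + y *\<^sub>R e) \<partial>lborel)
        = (\<integral>\<^sup>+y. f (?V x + (\<phi> (?V x) + y) *\<^sub>R e) \<partial>lborel)"
      using nn_integral_real_affine[of "\<lambda>y. f (?V x + y *\<^sub>R e)" 1 "\<phi> (?V x)"] by simp
    also have "\<dots> = (\<integral>\<^sup>+y. f (?V x + y *\<^sub>R e + \<phi> (?V x + y *\<^sub>R e) *\<^sub>R e) \<partial>lborel)"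
      unfolding inv[of "?V x"] by (simp add: algebra_simps)
    finally show ?thesis ..
  qed
  then show ?thesis
    unfolding fubini[OF f] by (subst fubini) simp_all
qed

lemma lborel_distr_shear:
  fixes e :: "'e::euclidean_space"
  assumes e: "e \<in> Basis"
    and [measurable]: "\<phi> \<in> borel_measurable borel"
    and inv: "\<And>z s. \<phi> (z + s *\<^sub>R e) = \<phi> z"
  shows "distr lborel borel (\<lambda>z. z + \<phi> z *\<^sub>R e) = lborel"
proof (rule measure_eqI)
  fix X assume "X \<in> sets (distr lborel borel (\<lambda>z. z + \<phi> z *\<^sub>R e))"
  then have [measurable]: "X \<in> sets borel" by simp
  have "emeasure (distr lborel borel (\<lambda>z. z + \<phi> z *\<^sub>R e)) X
      = (\<integral>\<^sup>+z. indicator X (z + \<phi> z *\<^sub>R e) \<partial>lborel)"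
    by (simp add: nn_integral_distr flip: nn_integral_indicator)
  also have "\<dots> = (\<integral>\<^sup>+z. indicator X z \<partial>lborel)"
    using assms by (intro nn_integral_shear) auto
  finally show "emeasure (distr lborel borel (\<lambda>z. z + \<phi> z *\<^sub>R e)) X = emeasure lborel X"
    by simp
qed simp

lemma lborel_distr_diagonal:
  fixes c :: "'e::euclidean_space \<Rightarrow> real"
  assumes c: "\<And>b. b \<in> Basis \<Longrightarrow> c b > 0"
  shows "distr lborel borel (\<lambda>z. \<Sum>b\<in>Basis. (c b * (z \<bullet> b)) *\<^sub>R b)
    = density lborel (\<lambda>_. ennreal (inverse (\<Prod>b\<in>Basis. c b)))"
proof -
  let ?D = "\<lambda>z. \<Sum>b\<in>Basis. (c b * (z \<bullet> b)) *\<^sub>R b :: 'e"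
  have P: "(\<Prod>b\<in>Basis. c b) > 0" using c by (intro prod_pos) auto
  have "lborel = density (distr lborel borel ?D) (\<lambda>_. \<Prod>b\<in>Basis. \<bar>c b\<bar>)"
    using lborel_affine_euclidean[of c 0] c by (auto simp: less_imp_neq[symmetric] dest: c)
  also have "(\<Prod>b\<in>Basis. \<bar>c b\<bar>) = (\<Prod>b\<in>Basis. c b)"
    using c by (intro prod.cong) (auto simp: less_imp_le)
  finally have "density lborel (\<lambda>_. ennreal (inverse (\<Prod>b\<in>Basis. c b)))
    = density (density (distr lborel borel ?D) (\<lambda>_. \<Prod>b\<in>Basis. c b)) (\<lambda>_. ennreal (inverse (\<Prod>b\<in>Basis. c b)))"
    by simp
  also have "\<dots> = distr lborel borel ?D"
    using P by (simp add: density_density_eq density_1 less_imp_neq[OF P, symmetric] flip: ennreal_mult)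
  finally show ?thesis ..
qed


text \<open>
  For an invertible linear map \<open>T\<close> the constant is \<open>1 / |det T|\<close>. All linear maps below are compositions
  of shears and diagonal maps, so that no determinant has to be computed.
\<close>

definition scales_lborel :: "('e::euclidean_space \<Rightarrow> 'e) \<Rightarrow> real \<Rightarrow> bool"
  where "scales_lborel T c \<longleftrightarrow> T \<in> borel_measurable borel \<and> c \<ge> 0 \<and>
    distr lborel borel T = density lborel (\<lambda>_. ennreal c)"

lemma scales_lborel_shear:
  fixes e :: "'e::euclidean_space"
  assumes "e \<in> Basis" "\<phi> \<in> borel_measurable borel" "\<And>z s. \<phi> (z + s *\<^sub>R e) = \<phi> z"
  shows "scales_lborel (\<lambda>z. z + \<phi> z *\<^sub>R e) 1"
  using lborel_distr_shear[OF assms] assms(2)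
  by (simp add: scales_lborel_def density_1)

lemma scales_lborel_diagonal:
  assumes "\<And>b. b \<in> Basis \<Longrightarrow> c b > 0"
  shows "scales_lborel (\<lambda>z. \<Sum>b\<in>Basis. (c b * (z \<bullet> b)) *\<^sub>R b) (inverse (\<Prod>b\<in>Basis. c b))"
  using lborel_distr_diagonal[of c] assms
  by (simp add: scales_lborel_def prod_nonneg less_imp_le)

lemma scales_lborel_compose:
  assumes T: "scales_lborel T c" and S: "scales_lborel S d"
  shows "scales_lborel (\<lambda>z. S (T z)) (c * d)"
proof -
  have [measurable]: "T \<in> borel_measurable borel" "S \<in> borel_measurable borel"
    and nn: "c \<ge> 0" "d \<ge> 0"
    using T S by (auto simp: scales_lborel_def)
  have "distr lborel borel (\<lambda>z. S (T z)) = distr (distr lborel borel T) borel S"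
    by (simp add: distr_distr o_def)
  also have "\<dots> = distr (density lborel (\<lambda>_. ennreal c)) borel S"
    using T by (simp add: scales_lborel_def)
  also have "\<dots> = density (distr lborel borel S) (\<lambda>_. ennreal c)"
    by (subst density_distr) (simp_all add: o_def)
  also have "\<dots> = density lborel (\<lambda>_. ennreal (c * d))"
    using S nn by (simp add: scales_lborel_def density_density_eq mult.commute flip: ennreal_mult)
  finally show ?thesis using nn by (simp add: scales_lborel_def)
qed

lemma scales_lborel_integral:
  fixes F :: "'e::euclidean_space \<Rightarrow> real"
  assumes T: "scales_lborel T c" and [measurable]: "F \<in> borel_measurable borel"
  shows "(LINT z|lborel. F (T z)) = c * (LINT z|lborel. F z)"
proof -
  have [measurable]: "T \<in> borel_measurable borel" and nn: "c \<ge> 0"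
    using T by (auto simp: scales_lborel_def)
  have "(LINT z|lborel. F (T z)) = (LINT z|distr lborel borel T. F z)"
    by (simp add: integral_distr)
  also have "\<dots> = (LINT z|density lborel (\<lambda>_. ennreal c). F z)"
    using T by (simp add: scales_lborel_def)
  also have "\<dots> = c * (LINT z|lborel. F z)"
    using nn by (simp add: integral_density)
  finally show ?thesis .
qed

lemma linear_imp_borel: "linear (f :: 'e::euclidean_space \<Rightarrow> 'f::euclidean_space) \<Longrightarrow> f \<in> borel_measurable borel"
  by (intro borel_measurable_continuous_onI linear_continuous_on linear_conv_bounded_linear[THEN iffD1])


section \<open>Integration along a linear flow\<close>

text \<open>
  The one-parameter group \<open>exp (s A)\<close> of a linear map with \<open>A\<^sup>3 = A\<close>: odd powers of \<open>A\<close> equal \<open>A\<close> and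
  positive even powers equal \<open>A\<^sup>2\<close>, so the exponential series splits into \<open>sinh\<close> and \<open>cosh\<close>. This covers
  hyperbolic rotations as well as the flows of projections.
\<close>

definition cubic_flow :: "('e::real_vector \<Rightarrow> 'e) \<Rightarrow> real \<Rightarrow> 'e \<Rightarrow> 'e"
  where "cubic_flow A s z = z + sinh s *\<^sub>R A z + (cosh s - 1) *\<^sub>R A (A z)"

lemma cubic_flow_derivative:
  fixes A :: "'e::euclidean_space \<Rightarrow> 'e"
  assumes A: "linear A" "\<And>z. A (A (A z)) = A z"
  shows "((\<lambda>s. cubic_flow A s z) has_vector_derivative A (cubic_flow A s z)) (at s)"
proof -
  have "A (cubic_flow A s z) = cosh s *\<^sub>R A z + sinh s *\<^sub>R A (A z)"
    using A by (simp add: cubic_flow_def linear_add linear_cmul linear_diff algebra_simps)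
  moreover have "((\<lambda>s. cubic_flow A s z) has_vector_derivative cosh s *\<^sub>R A z + sinh s *\<^sub>R A (A z)) (at s)"
    unfolding cubic_flow_def by (auto intro!: derivative_eq_intros)
  ultimately show ?thesis by simp
qed

lemma cubic_flow_inverse:
  assumes A: "linear A" "\<And>z. A (A (A z)) = A z"
  shows "cubic_flow A (- s) (cubic_flow A s z) = z"
proof -
  have 1: "A (cubic_flow A s z) = cosh s *\<^sub>R A z + sinh s *\<^sub>R A (A z)"
    using A by (simp add: cubic_flow_def linear_add linear_cmul linear_diff algebra_simps)
  have 2: "A (A (cubic_flow A s z)) = cosh s *\<^sub>R A (A z) + sinh s *\<^sub>R A z"
    using A by (simp add: 1 linear_add linear_cmul)
  have "cubic_flow A (- s) (cubic_flow A s z)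
      = z + (sinh s + (- sinh s * cosh s + (cosh s - 1) * sinh s)) *\<^sub>R A z
        + ((cosh s - 1) + (- sinh s * sinh s + (cosh s - 1) * cosh s)) *\<^sub>R A (A z)"
    unfolding cubic_flow_def[of A "- s"] 2 unfolding 1
    by (simp add: cubic_flow_def algebra_simps)
  moreover have "sinh s + (- sinh s * cosh s + (cosh s - 1) * sinh s) = 0"
    by (simp add: algebra_simps)
  moreover have "(cosh s - 1) + (- sinh s * sinh s + (cosh s - 1) * cosh s) = 0"
    using cosh_square_eq[of s] by (simp add: algebra_simps power2_eq_square)
  ultimately show ?thesis by simp
qed

lemma cubic_flow_idempotent:
  assumes "A (A z) = A z"
  shows "cubic_flow A s z = z + (exp s - 1) *\<^sub>R A z"
  unfolding cubic_flow_def assms sinh_plus_cosh[symmetric] by (simp add: algebra_simps)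

lemma cubic_flow_mem_iff:
  assumes A: "linear A" "\<And>z. A (A (A z)) = A z"
    and inv: "\<And>s z. z \<in> B \<Longrightarrow> cubic_flow A s z \<in> B"
  shows "cubic_flow A s z \<in> B \<longleftrightarrow> z \<in> B"
  using inv[of "cubic_flow A s z" "- s"] inv[of z s] cubic_flow_inverse[OF A] by auto

text \<open>
  Let \<open>f = g e\<^sup>-\<^sup>L\<close>. Since the flow multiplies \<open>w\<close> by \<open>e\<^sup>k\<^sup>s\<close> and volumes by \<open>e\<^sup>\<tau>\<^sup>s\<close>, the integral of
  \<open>e\<^bsup>(k+\<tau>)s\<^esup> f(\<Phi>\<^sub>s z) w(z)\<close> does not depend on \<open>s\<close>. Its derivative at \<open>s = 0\<close> is the integral in the
  conclusion. Differentiation under the integral sign is justified by dominated convergence: for small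
  \<open>s\<close> the flow at most halves \<open>L\<close> on the support of \<open>w\<close>, because \<open>L (A z) \<ge> - L z\<close>, and this leaves enough
  of the exponential decay to absorb all polynomial factors. The sign condition on \<open>L (A (A z))\<close>
  controls the \<open>cosh\<close> part of the flow.
\<close>

lemma integral_along_flow_zero:
  fixes A :: "'e::euclidean_space \<Rightarrow> 'e" and L w g :: "'e \<Rightarrow> real"
  assumes A: "linear A" "\<And>z. A (A (A z)) = A z"
    and L: "linear L"
    and w[measurable]: "w \<in> borel_measurable borel" and w_nonneg: "\<And>z. w z \<ge> 0"
    and K: "K > 0" and norm_le: "\<And>z. w z \<noteq> 0 \<Longrightarrow> norm z \<le> K * L z"
    and L_A: "\<And>z. w z \<noteq> 0 \<Longrightarrow> - L z \<le> L (A z)" "\<And>z. w z \<noteq> 0 \<Longrightarrow> 0 \<le> L (A (A z))"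
    and int_w: "\<And>\<epsilon>. \<epsilon> > 0 \<Longrightarrow> integrable lborel (\<lambda>z. w z * exp (- \<epsilon> * L z))"
    and w_flow: "\<And>s z. w (cubic_flow A s z) = exp (k * s) * w z"
    and vol_flow: "\<And>s. s > 0 \<Longrightarrow> scales_lborel (cubic_flow A s) (exp (- \<tau> * s))"
    and g: "real_polynomial_function g"
  shows "(LINT z|lborel. (dir_deriv (A z) g z + (k + \<tau> - L (A z)) * g z) * exp (- L z) * w z) = 0"
proof -
  let ?\<Phi> = "cubic_flow A"
  define P where "P z = dir_deriv (A z) g z + (k + \<tau> - L (A z)) * g z" for z
  define h where "h s z = g (?\<Phi> s z) * exp (- L (?\<Phi> s z)) * exp ((k + \<tau>) * s)" for s z
  \<comment> \<open>Up to time \<open>s0\<close> one has \<open>sinh s \<le> 1/2\<close>, so \<open>L\<close> is at most halved.\<close>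
  define s0 where "s0 = min 1 (arsinh (1/2 :: real))"
  have s0: "s0 > 0" by (simp add: s0_def)
  have sinh_le: "sinh s \<le> 1/2" if "s \<le> s0" for s :: real
  proof -
    have "sinh s \<le> sinh (arsinh (1/2))" using that by (subst sinh_real_le_iff) (simp add: s0_def)
    then show ?thesis by simp
  qed
  have blL: "bounded_linear L" using L by (simp add: linear_conv_bounded_linear)
  have blA: "bounded_linear A" using A by (simp add: linear_conv_bounded_linear)
  have P: "real_polynomial_function P"
    unfolding P_def
    by (intro real_polynomial_add real_polynomial_mult real_polynomial_function_diff real_polynomial_const
        real_polynomial_function_dir_deriv_field g A real_polynomial_linear bounded_linear_compose[OF blL blA])
  have \<Phi>_meas[measurable]: "?\<Phi> s \<in> borel_measurable borel" for s
    unfolding cubic_flow_def using linear_imp_borel[OF A(1)] by measurable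
  have [measurable]: "L \<in> borel_measurable borel" by (rule linear_imp_borel[OF L])
  note [measurable] = real_polynomial_borel[OF g] real_polynomial_borel[OF P]
  have L_nonneg: "L z \<ge> 0" if "w z \<noteq> 0" for z
    using norm_le[OF that] K norm_ge_zero[of z] by (metis order_trans zero_le_mult_iff not_le)
  obtain M where M: "M > 0" "\<And>z. norm (A z) \<le> norm z * M"
    using bounded_linear.pos_bounded[OF blA] by blast
  define N where "N = 1 + sinh 1 * M + cosh 1 * M * M"
  have N: "N > 0" using M by (simp add: N_def add_pos_pos)
  have \<Phi>_norm: "norm (?\<Phi> s z) \<le> N * norm z" if "0 \<le> s" "s \<le> s0" for s z
  proof -
    have "s \<le> 1" using that by (simp add: s0_def)
    have sc: "0 \<le> sinh s" "sinh s \<le> sinh 1" "0 \<le> cosh s - 1" "cosh s - 1 \<le> cosh 1"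
      using that \<open>s \<le> 1\<close> cosh_real_ge_1[of s] by (auto simp: cosh_real_nonneg_le_iff intro: order_trans[of _ "cosh s"])
    have "norm (A (A z)) \<le> norm (A z) * M" by (rule M)
    also have "\<dots> \<le> norm z * M * M" using M by (intro mult_right_mono) auto
    finally have AA: "norm (A (A z)) \<le> norm z * M * M" .
    have "norm (?\<Phi> s z) \<le> norm z + norm (sinh s *\<^sub>R A z) + norm ((cosh s - 1) *\<^sub>R A (A z))"
      unfolding cubic_flow_def by (intro norm_triangle_le add_mono norm_triangle_ineq order_refl)
    also have "\<dots> = norm z + sinh s * norm (A z) + (cosh s - 1) * norm (A (A z))"
      using sc by simp
    also have "\<dots> \<le> norm z + sinh 1 * (norm z * M) + cosh 1 * (norm z * M * M)"
      using sc M(1) by (intro add_mono mult_mono M(2) AA order_refl) auto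
    finally show ?thesis by (simp add: N_def algebra_simps)
  qed
  have L_\<Phi>: "L (?\<Phi> s z) \<ge> L z / 2" if "0 \<le> s" "s \<le> s0" "w z \<noteq> 0" for s z
  proof -
    have "L (?\<Phi> s z) = L z + sinh s * L (A z) + (cosh s - 1) * L (A (A z))"
      using L by (simp add: cubic_flow_def linear_add linear_cmul)
    moreover have "sinh s * L (A z) \<ge> sinh s * (- L z)"
      using that L_A(1) by (intro mult_left_mono) auto
    moreover have "sinh s * L z \<le> 1/2 * L z"
      using sinh_le that L_nonneg by (intro mult_right_mono) auto
    moreover have "(cosh s - 1) * L (A (A z)) \<ge> 0"
      using L_A(2) that cosh_real_ge_1[of s] by (intro mult_nonneg_nonneg) auto
    ultimately show ?thesis by simp
  qed
  have dom: "\<exists>C\<ge>0. \<forall>s z. 0 \<le> s \<longrightarrow> s \<le> s0 \<longrightarrow>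
      \<bar>q (?\<Phi> s z) * exp (- L (?\<Phi> s z)) * exp ((k + \<tau>) * s)\<bar> * w z \<le> C * (w z * exp (- (1/4) * L z))"
    if q: "real_polynomial_function q" for q
  proof -
    \<comment> \<open>The rate is chosen so that the polynomial costs \<open>exp (L z / 4)\<close> along the flow, which leaves
      \<open>exp (- L z / 4)\<close> of the available \<open>exp (- L z / 2)\<close>.\<close>
    obtain C where C: "C \<ge> 0" "\<And>z. \<bar>q z\<bar> \<le> C * exp (1 / (4 * N * K) * norm z)"
      using real_polynomial_growth[OF q, of "1 / (4 * N * K)"] N K by auto
    have "\<bar>q (?\<Phi> s z) * exp (- L (?\<Phi> s z)) * exp ((k + \<tau>) * s)\<bar> * w z
        \<le> C * exp \<bar>k + \<tau>\<bar> * (w z * exp (- (1/4) * L z))" if s: "0 \<le> s" "s \<le> s0" for s z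
    proof (cases "w z = 0")
      case False
      have "1 / (4 * N * K) * norm (?\<Phi> s z) \<le> 1 / (4 * N * K) * (N * (K * L z))"
        using N K \<Phi>_norm[OF s, of z] norm_le[OF False]
        by (intro mult_left_mono order_trans[OF \<Phi>_norm[OF s]]) auto
      also have "\<dots> = L z / 4" using N K by simp
      finally have "\<bar>q (?\<Phi> s z)\<bar> \<le> C * exp (L z / 4)"
        using C by (intro order_trans[OF C(2)] mult_left_mono) auto
      moreover have "exp (- L (?\<Phi> s z)) \<le> exp (- (L z / 2))"
        using L_\<Phi>[OF s False] by simp
      moreover have "(k + \<tau>) * s \<le> \<bar>k + \<tau>\<bar>"
      proof -
        have "(k + \<tau>) * s \<le> \<bar>k + \<tau>\<bar> * s" using s by (intro mult_right_mono) auto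
        also have "\<dots> \<le> \<bar>k + \<tau>\<bar> * 1" using s by (intro mult_left_mono) (auto simp: s0_def)
        finally show ?thesis by simp
      qed
      ultimately have "\<bar>q (?\<Phi> s z)\<bar> * exp (- L (?\<Phi> s z)) * exp ((k + \<tau>) * s) * w z
          \<le> C * exp (L z / 4) * exp (- (L z / 2)) * exp \<bar>k + \<tau>\<bar> * w z"
        using C w_nonneg by (intro mult_mono) auto
      also have "\<dots> = C * exp \<bar>k + \<tau>\<bar> * (w z * (exp (L z / 4) * exp (- (L z / 2))))"
        by (simp only: mult_ac)
      also have "exp (L z / 4) * exp (- (L z / 2)) = exp (- (1/4) * L z)"
        by (simp flip: exp_add)
      finally show ?thesis by (simp add: abs_mult)
    qed simp
    then show ?thesis using C by (intro exI[of _ "C * exp \<bar>k + \<tau>\<bar>"]) auto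
  qed
  have int_h: "integrable lborel (\<lambda>z. h s z * w z)" if "0 \<le> s" "s \<le> s0" for s
  proof -
    obtain C where C: "C \<ge> 0" "\<And>s z. 0 \<le> s \<Longrightarrow> s \<le> s0 \<Longrightarrow> \<bar>h s z\<bar> * w z \<le> C * (w z * exp (- (1/4) * L z))"
      using dom[OF g] unfolding h_def by blast
    show ?thesis
    proof (rule Bochner_Integration.integrable_bound)
      show "integrable lborel (\<lambda>z. C * (w z * exp (- (1/4) * L z)))"
        using int_w[of "1/4"] by (intro integrable_mult_right) auto
      show "(\<lambda>z. h s z * w z) \<in> borel_measurable lborel" unfolding h_def by measurable
      show "AE z in lborel. norm (h s z * w z) \<le> norm (C * (w z * exp (- (1/4) * L z)))"
        using C(2)[OF that] w_nonneg C(1) by (auto simp: abs_mult)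
    qed
  qed
  have h_const: "(LINT z|lborel. h s z * w z) = (LINT z|lborel. h 0 z * w z)" if "s > 0" for s
  proof -
    have "h s z * w z = exp (\<tau> * s) * (g (?\<Phi> s z) * exp (- L (?\<Phi> s z)) * w (?\<Phi> s z))" for z
      by (simp add: h_def w_flow algebra_simps exp_add)
    then have "(LINT z|lborel. h s z * w z) = exp (\<tau> * s) *
        (LINT z|lborel. (\<lambda>y. g y * exp (- L y) * w y) (?\<Phi> s z))"
      by simp
    also have "\<dots> = exp (\<tau> * s) * (exp (- \<tau> * s) * (LINT z|lborel. g z * exp (- L z) * w z))"
      using vol_flow[OF that] by (subst scales_lborel_integral) auto
    also have "\<dots> = (LINT z|lborel. h 0 z * w z)"
      by (simp add: h_def cubic_flow_def mult.assoc[symmetric] flip: exp_add)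
    finally show ?thesis .
  qed
  have h_deriv: "((\<lambda>s. h s z) has_real_derivative
      P (?\<Phi> s z) * exp (- L (?\<Phi> s z)) * exp ((k + \<tau>) * s)) (at s)" for s z
  proof -
    note dv = cubic_flow_derivative[OF A, of z s]
    have dg: "((\<lambda>s. g (?\<Phi> s z)) has_real_derivative dir_deriv (A (?\<Phi> s z)) g (?\<Phi> s z)) (at s)"
      using vector_derivative_diff_chain_within[OF dv has_derivative_dir_deriv[OF g, THEN has_derivative_at_withinI]]
      by (simp add: o_def has_real_derivative_iff_has_vector_derivative)
    have dL: "((\<lambda>s. L (?\<Phi> s z)) has_real_derivative L (A (?\<Phi> s z))) (at s)"
      using bounded_linear.has_vector_derivative[OF blL dv]
      by (simp add: has_real_derivative_iff_has_vector_derivative)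
    show ?thesis unfolding h_def P_def
      by (rule derivative_eq_intros dg dL refl)+ (simp add: algebra_simps)
  qed
  \<comment> \<open>Difference quotients along a sequence of times: each has integral zero, and by the mean value theorem
    they are dominated by the bound for the derivative.\<close>
  define t where "t j = s0 / real (Suc j)" for j :: nat
  have t: "t j > 0" "t j \<le> s0" for j
    using s0 by (auto simp: t_def field_simps)
  have t_lim: "t \<longlonglongrightarrow> 0" unfolding t_def using LIMSEQ_Suc[OF lim_const_over_n[of s0]] by simp
  define q where "q j z = (h (t j) z - h 0 z) / t j * w z" for j z
  obtain C where C: "C \<ge> 0" "\<And>s z. 0 \<le> s \<Longrightarrow> s \<le> s0 \<Longrightarrow>
      \<bar>P (?\<Phi> s z) * exp (- L (?\<Phi> s z)) * exp ((k + \<tau>) * s)\<bar> * w z \<le> C * (w z * exp (- (1/4) * L z))"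
    using dom[OF P] by blast
  have "(\<lambda>j. LINT z|lborel. q j z) \<longlonglongrightarrow> (LINT z|lborel. P z * exp (- L z) * w z)"
  proof (rule integral_dominated_convergence)
    show "(\<lambda>z. P z * exp (- L z) * w z) \<in> borel_measurable lborel" by measurable
    show "q j \<in> borel_measurable lborel" for j
      unfolding q_def h_def by measurable
    show "integrable lborel (\<lambda>z. C * (w z * exp (- (1/4) * L z)))"
      using int_w[of "1/4"] by (intro integrable_mult_right) auto
    have "(\<lambda>j. q j z) \<longlonglongrightarrow> P z * exp (- L z) * w z" for z
    proof -
      have "((\<lambda>s. (h s z - h 0 z) / s) \<longlongrightarrow> P z * exp (- L z)) (at 0)"
        using h_deriv[of z 0] by (simp add: DERIV_def cubic_flow_def)
      moreover have "filterlim t (at 0) sequentially"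
        unfolding filterlim_at using t_lim t by (auto simp: less_imp_neq[symmetric] intro!: always_eventually)
      ultimately show ?thesis unfolding q_def
        by (intro tendsto_mult tendsto_const) (rule filterlim_compose)
    qed
    then show "AE z in lborel. (\<lambda>j. q j z) \<longlonglongrightarrow> P z * exp (- L z) * w z" by simp
    have "norm (q j z) \<le> C * (w z * exp (- (1/4) * L z))" for j z
    proof -
      obtain \<xi> where \<xi>: "0 < \<xi>" "\<xi> < t j"
        "h (t j) z - h 0 z = (t j - 0) * (P (?\<Phi> \<xi> z) * exp (- L (?\<Phi> \<xi> z)) * exp ((k + \<tau>) * \<xi>))"
        using MVT2[OF t(1), of j "\<lambda>s. h s z", OF h_deriv] by blast
      have "q j z = P (?\<Phi> \<xi> z) * exp (- L (?\<Phi> \<xi> z)) * exp ((k + \<tau>) * \<xi>) * w z"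
        unfolding q_def \<xi>(3) using t(1)[of j] by simp
      then show ?thesis
        using C(2)[of \<xi> z] \<xi> t(2)[of j] w_nonneg[of z] by (simp add: abs_mult)
    qed
    then show "AE z in lborel. norm (q j z) \<le> C * (w z * exp (- (1/4) * L z))" for j by simp
  qed
  moreover have "(LINT z|lborel. q j z) = 0" for j
  proof -
    have "(LINT z|lborel. q j z) = (LINT z|lborel. (h (t j) z * w z - h 0 z * w z) / t j)"
      unfolding q_def by (simp add: left_diff_distrib)
    also have "\<dots> = ((LINT z|lborel. h (t j) z * w z) - (LINT z|lborel. h 0 z * w z)) / t j"
      using int_h[of "t j"] int_h[of 0] t[of j] s0
      by (simp add: Bochner_Integration.integral_diff)
    also have "\<dots> = 0" using h_const[OF t(1)] by simp
    finally show ?thesis .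
  qed
  ultimately have "(LINT z|lborel. P z * exp (- L z) * w z) = 0"
    by (simp add: LIMSEQ_const_iff)
  then show ?thesis by (simp add: P_def)
qed

section \<open>The domain and its weight\<close>

text \<open>
  The signed sum \<open>|y|\<close> as a function on the product space; it is the time coordinate of the Lorentzian
  form \<open>|y|\<^sup>2 - \<parallel>x\<parallel>\<^sup>2\<close> in the weight.
\<close>

abbreviation height :: "(real^'a) \<times> (real^'b) \<Rightarrow> real"
  where "height z \<equiv> ysum (snd z)"

abbreviation dir_x :: "'a::finite \<Rightarrow> (real^'a) \<times> (real^'b)"
  where "dir_x i \<equiv> (axis i 1, 0)"

abbreviation dir_y :: "'b::finite \<Rightarrow> (real^'a) \<times> (real^'b)"
  where "dir_y i \<equiv> (0, axis i 1)"

definition decay :: "(real^'a) \<times> (real^'b::{finite,linorder}) \<Rightarrow> real"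
  where "decay z = ysum' (snd z) + ysum (snd z)"

text \<open>
  The weight without its factor \<open>exp (- decay z)\<close>, extended by zero outside the domain. It is this part
  that the flows below multiply by a constant.
\<close>

definition base_weight :: "real \<Rightarrow> ('b \<Rightarrow> real) \<Rightarrow> (real^'a) \<times> (real^'b::{finite,linorder}) \<Rightarrow> real"
  where "base_weight a \<kappa> z = indicator B_Sigma z *
    (((height z)\<^sup>2 - (norm (fst z))\<^sup>2) powr a * (\<Prod>i\<in>UNIV - {last_ix}. (snd z $ i) powr \<kappa> i))"

lemma ysum_add: "ysum (x + y) = ysum x + ysum y"
  by (simp add: ysum_def sum.distrib)

lemma ysum_scaleR: "ysum (c *\<^sub>R x) = c * ysum x"
  by (simp add: ysum_def sum_distrib_left)

lemma ysum_axis: "ysum (axis i c) = c"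
  by (simp add: ysum_def axis_def)

lemma ysum'_add: "ysum' (x + y) = ysum' x + ysum' y"
  by (simp add: ysum'_def sum.distrib)

lemma ysum'_scaleR: "ysum' (c *\<^sub>R x) = c * ysum' x"
  by (simp add: ysum'_def sum_distrib_left)

lemma ysum'_axis: "ysum' (axis i c) = (if i = last_ix then 0 else c)"
  by (simp add: ysum'_def axis_def)

lemma ysum_eq: "ysum y = ysum' y + y $ last_ix"
  by (simp add: ysum_def ysum'_def sum.remove[of UNIV last_ix])

lemma linear_height: "linear height"
  by (rule linearI) (simp_all add: ysum_add ysum_scaleR)

lemma linear_decay: "linear decay"
  by (rule linearI) (simp_all add: decay_def ysum_add ysum_scaleR ysum'_add ysum'_scaleR algebra_simps)

lemma continuous_on_ysum [continuous_intros]: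
  "continuous_on S f \<Longrightarrow> continuous_on S (\<lambda>z. ysum (f z))"
  unfolding ysum_def by (intro continuous_intros)

lemma continuous_on_ysum' [continuous_intros]:
  "continuous_on S f \<Longrightarrow> continuous_on S (\<lambda>z. ysum' (f z))"
  unfolding ysum'_def by (intro continuous_intros)

lemma mem_B_Sigma_iff:
  "z \<in> B_Sigma \<longleftrightarrow> (\<forall>i. i \<noteq> last_ix \<longrightarrow> 0 \<le> snd z $ i) \<and> norm (fst z) \<le> height z"
  using order_trans[OF norm_ge_zero] by (auto simp: B_Sigma_def R_Sigma_def case_prod_beta)

lemma B_Sigma_borel [measurable]: "(B_Sigma :: ((real^'a) \<times> (real^'b::{finite,linorder})) set) \<in> sets borel"
proof -
  have 1: "closed (\<Inter>i\<in>UNIV - {last_ix}. {z :: (real^'a) \<times> (real^'b::{finite,linorder}). 0 \<le> snd z $ i})"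
    by (intro closed_INT ballI closed_Collect_le continuous_intros)
  have 2: "closed {z :: (real^'a) \<times> (real^'b::{finite,linorder}). norm (fst z) \<le> height z}"
    by (intro closed_Collect_le continuous_intros)
  have 3: "B_Sigma = (\<Inter>i\<in>UNIV - {last_ix}. {z :: (real^'a) \<times> (real^'b::{finite,linorder}). 0 \<le> snd z $ i})
      \<inter> {z. norm (fst z) \<le> height z}"
    by (auto simp: mem_B_Sigma_iff)
  show ?thesis unfolding 3 by (intro borel_closed closed_Int 1 2)
qed

lemma base_weight_borel [measurable]: "base_weight a \<kappa> \<in> borel_measurable borel"
proof -
  have [measurable]: "(\<lambda>z. (height z)\<^sup>2 - (norm (fst z))\<^sup>2) \<in> borel_measurable borel"
    "(\<lambda>z. snd z $ i) \<in> borel_measurable borel" for i :: 'b and z :: "(real^'a) \<times> (real^'b::{finite,linorder})"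
    by (intro borel_measurable_continuous_onI continuous_intros)+
  show ?thesis unfolding base_weight_def by measurable
qed

lemma base_weight_nonneg: "base_weight a \<kappa> z \<ge> 0"
  by (auto simp: base_weight_def intro!: mult_nonneg_nonneg prod_nonneg)

lemma base_weight_support: "base_weight a \<kappa> z \<noteq> 0 \<Longrightarrow> z \<in> B_Sigma"
  by (auto simp: base_weight_def indicator_def split: if_splits)

lemma ysum'_nonneg: "z \<in> B_Sigma \<Longrightarrow> ysum' (snd z) \<ge> 0"
  by (auto simp: mem_B_Sigma_iff ysum'_def intro!: sum_nonneg)

lemma height_ge_norm: "z \<in> B_Sigma \<Longrightarrow> norm (fst z) \<le> height z"
  by (simp add: mem_B_Sigma_iff)

lemma height_nonneg: "z \<in> B_Sigma \<Longrightarrow> 0 \<le> height z"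
  using height_ge_norm[of z] norm_ge_zero[of "fst z"] by linarith

lemma norm_le_decay:
  assumes "z \<in> B_Sigma"
  shows "norm z \<le> 3 * decay z"
proof -
  have "norm z \<le> norm (fst z) + norm (snd z)"
    using norm_Pair_le[of "fst z" "snd z"] by simp
  also have "norm (snd z) \<le> (\<Sum>i\<in>UNIV. \<bar>snd z $ i\<bar>)" by (rule norm_le_l1_cart)
  also have "\<dots> = (\<Sum>i\<in>UNIV - {last_ix}. \<bar>snd z $ i\<bar>) + \<bar>snd z $ last_ix\<bar>"
    by (simp add: sum.remove[of UNIV last_ix])
  also have "(\<Sum>i\<in>UNIV - {last_ix}. \<bar>snd z $ i\<bar>) = ysum' (snd z)"
    unfolding ysum'_def using assms by (intro sum.cong) (auto simp: mem_B_Sigma_iff)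
  finally show ?thesis
    using ysum'_nonneg[OF assms] height_ge_norm[OF assms] height_nonneg[OF assms] ysum_eq[of "snd z"]
    by (simp add: decay_def)
qed

lemma dir_in_Basis: "dir_x i \<in> Basis" "dir_y j \<in> Basis"
  by (auto simp: Basis_prod_def Basis_vec_def)

lemma inner_dir: "z \<bullet> dir_x i = fst z $ i" "z \<bullet> dir_y j = snd z $ j"
  by (auto simp: inner_prod_def inner_axis)

lemma Basis_cases:
  fixes b :: "(real^'a) \<times> (real^'b)"
  assumes "b \<in> Basis"
  obtains i where "b = dir_x i" | j where "b = dir_y j"
  using assms by (auto simp: Basis_prod_def Basis_vec_def)

lemma prod_Basis_pair:
  fixes F :: "(real^'a) \<times> (real^'b) \<Rightarrow> 'c::comm_monoid_mult"
  shows "(\<Prod>b\<in>Basis. F b) = (\<Prod>i\<in>UNIV. F (dir_x i)) * (\<Prod>j\<in>UNIV. F (dir_y j))"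
proof -
  have B: "Basis = range dir_x \<union> (range dir_y :: ((real^'a) \<times> (real^'b)) set)"
    by (auto simp: Basis_prod_def Basis_vec_def)
  have "range dir_x \<inter> (range dir_y :: ((real^'a) \<times> (real^'b)) set) = {}"
    by (auto simp: axis_eq_0_iff)
  moreover have "inj (dir_x :: 'a \<Rightarrow> (real^'a) \<times> (real^'b))" "inj (dir_y :: 'b \<Rightarrow> (real^'a) \<times> (real^'b))"
    by (auto simp: inj_def axis_eq_axis)
  ultimately show ?thesis
    unfolding B by (subst prod.union_disjoint) (auto simp: prod.reindex)
qed

section \<open>Integrability of the weight\<close>

text \<open>
  On the half line this is a rescaled Gamma integral; the even extension lets it be used for
  coordinates of either sign.
\<close>

lemma nn_integral_powr_exp_finite:
  fixes a \<epsilon> :: real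
  assumes a: "a > - 1" and \<epsilon>: "\<epsilon> > 0"
  shows "(\<integral>\<^sup>+t. ennreal (\<bar>t\<bar> powr a * exp (- \<epsilon> * \<bar>t\<bar>)) \<partial>lborel) < \<infinity>"
proof -
  define f where "f t = ennreal (indicator {0..} t * t powr a * exp (- \<epsilon> * t))" for t
  have [measurable]: "f \<in> borel_measurable borel" unfolding f_def by measurable
  have "(\<integral>\<^sup>+t. f t \<partial>lborel) = ennreal \<bar>1 / \<epsilon>\<bar> * (\<integral>\<^sup>+t. f (0 + 1 / \<epsilon> * t) \<partial>lborel)"
    using \<epsilon> by (intro nn_integral_real_affine) auto
  also have "(\<integral>\<^sup>+t. f (0 + 1 / \<epsilon> * t) \<partial>lborel)
      = (\<integral>\<^sup>+t. ennreal ((1 / \<epsilon>) powr a) * ennreal (indicator {0..} t * t powr a / exp t) \<partial>lborel)"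
    using \<epsilon> by (intro nn_integral_cong)
      (auto simp: f_def indicator_def powr_divide exp_minus field_simps simp flip: ennreal_mult')
  also have "\<dots> = ennreal ((1 / \<epsilon>) powr a) * ennreal (Gamma (a + 1))"
    using a Gamma_conv_nn_integral_real[of "a + 1"] by (simp add: nn_integral_cmult)
  finally have fin: "(\<integral>\<^sup>+t. f t \<partial>lborel) < \<infinity>"
    by (simp add: ennreal_mult_less_top)
  have "(\<integral>\<^sup>+t. f (- t) \<partial>lborel) = (\<integral>\<^sup>+t. f t \<partial>lborel)"
    using nn_integral_real_affine[of f "-1" 0] by simp
  moreover have "(\<integral>\<^sup>+t. ennreal (\<bar>t\<bar> powr a * exp (- \<epsilon> * \<bar>t\<bar>)) \<partial>lborel)
      \<le> (\<integral>\<^sup>+t. f t + f (- t) \<partial>lborel)"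
    by (intro nn_integral_mono) (auto simp: f_def indicator_def)
  moreover have "\<dots> = (\<integral>\<^sup>+t. f t \<partial>lborel) + (\<integral>\<^sup>+t. f (- t) \<partial>lborel)"
    by (intro nn_integral_add) measurable
  ultimately show ?thesis using fin by (simp add: le_less_trans)
qed

lemma nn_integral_prod_powr_exp_finite:
  fixes p :: "'e::euclidean_space \<Rightarrow> real"
  assumes "\<And>b. b \<in> Basis \<Longrightarrow> p b > - 1" "\<epsilon> > 0"
  shows "(\<integral>\<^sup>+z. ennreal (\<Prod>b\<in>Basis. \<bar>z \<bullet> b\<bar> powr p b * exp (- \<epsilon> * \<bar>z \<bullet> b\<bar>)) \<partial>lborel) < \<infinity>"
proof -
  have "(\<integral>\<^sup>+z. ennreal (\<Prod>b\<in>Basis. \<bar>z \<bullet> b\<bar> powr p b * exp (- \<epsilon> * \<bar>z \<bullet> b\<bar>)) \<partial>lborel)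
      = (\<integral>\<^sup>+z. (\<Prod>b\<in>Basis. ennreal (\<bar>z \<bullet> b\<bar> powr p b * exp (- \<epsilon> * \<bar>z \<bullet> b\<bar>))) \<partial>lborel)"
    by (simp add: prod_ennreal)
  also have "\<dots> = (\<Prod>b\<in>Basis. \<integral>\<^sup>+t. ennreal (\<bar>t\<bar> powr p b * exp (- \<epsilon> * \<bar>t\<bar>)) \<partial>lborel)"
    by (rule nn_integral_lborel_prod) auto
  also have "\<dots> < \<infinity>"
    using nn_integral_powr_exp_finite[OF assms(1) assms(2)]
    by (auto simp: less_top[symmetric] ennreal_prod_eq_top)
  finally show ?thesis .
qed

lemma AE_lborel_coordinates_nonzero:
  "AE z in lborel. \<forall>b\<in>Basis. z \<bullet> b \<noteq> (0::real)"
proof (rule AE_finite_allI)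
  fix b :: "'e::euclidean_space" assume b: "b \<in> Basis"
  have "negligible {z. b \<bullet> z = 0}" using b by (intro negligible_hyperplane) auto
  moreover have "closed {z. b \<bullet> z = 0}" by (rule closed_hyperplane)
  ultimately have "{z. b \<bullet> z = 0} \<in> null_sets lborel"
    by (simp add: negligible_iff_null_sets null_sets_completion_iff)
  then show "AE z in lborel. z \<bullet> b \<noteq> 0"
    by (rule AE_I') (auto simp: inner_commute)
qed simp

lemma powr_le_exp:
  fixes t b \<delta> :: real
  assumes "t \<ge> 0" "b > 0" "\<delta> > 0"
  shows "t powr b \<le> (b / \<delta>) powr b * exp (\<delta> * t)"
proof -
  have "t = (b / \<delta>) * (\<delta> * t / b)" using assms by simp
  also have "\<dots> powr b = (b / \<delta>) powr b * (\<delta> * t / b) powr b"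
    by (rule powr_mult)
  also have "(\<delta> * t / b) powr b \<le> exp (\<delta> * t / b) powr b"
  proof (rule powr_mono2)
    show "\<delta> * t / b \<le> exp (\<delta> * t / b)" using exp_ge_add_one_self[of "\<delta> * t / b"] by linarith
  qed (use assms in auto)
  also have "exp (\<delta> * t / b) powr b = exp (\<delta> * t)" using assms by (simp add: exp_powr_real)
  finally show ?thesis by (simp add: mult_left_mono)
qed

text \<open>
  The shear that replaces \<open>y\<^sub>d\<close> by \<open>\<tau> = |y| - \<parallel>x\<parallel>\<close> separates the variables up to the factor
  \<open>(|y|\<^sup>2 - \<parallel>x\<parallel>\<^sup>2)\<^sup>a = \<tau>\<^sup>a (\<tau> + 2 \<parallel>x\<parallel>)\<^sup>a\<close>. As \<open>a \<le> 0\<close>, the second power is at most \<open>|x\<^sub>i|\<^sup>a\<close> for any single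
  coordinate \<open>x\<^sub>i \<noteq> 0\<close>, so almost everywhere, and the exponential splits because \<open>\<parallel>x\<parallel>\<close> dominates the average of the \<open>|x\<^sub>i|\<close>. What
  remains is a product of integrable functions of one variable, since \<open>a > -1\<close> and \<open>\<kappa>\<^sub>j > -1\<close>.
\<close>

lemma base_weight_integrable_nonpos:
  fixes \<kappa> :: "'b::{finite,linorder} \<Rightarrow> real"
  assumes a: "a > - 1" "a \<le> 0" and \<kappa>: "\<And>i. i \<noteq> last_ix \<Longrightarrow> \<kappa> i > - 1" and \<epsilon>: "\<epsilon> > 0"
  shows "integrable lborel (\<lambda>z :: (real^'a) \<times> (real^'b::{finite,linorder}). base_weight a \<kappa> z * exp (- \<epsilon> * decay z))"
proof -
  obtain i0 :: 'a where True by blast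
  \<comment> \<open>Exponents of the dominating product: \<open>a\<close> for the sheared last coordinate and for one coordinate of \<open>x\<close>,
    zero for the others in \<open>x\<close>, and \<open>\<kappa>\<close> for the rest.\<close>
  define p :: "(real^'a) \<times> (real^'b::{finite,linorder}) \<Rightarrow> real" where
    "p b = a * fst b $ i0 + (\<Sum>j\<in>UNIV. (if j = last_ix then a else \<kappa> j) * snd b $ j)" for b
  have p_y: "p (dir_y j) = (if j = last_ix then a else \<kappa> j)" for j
    unfolding p_def by (subst sum.remove[of UNIV j]) (auto simp: axis_def intro!: sum.neutral)
  have p_x: "p (dir_x i) = (if i = i0 then a else 0)" for i
    by (auto simp: p_def axis_def)
  have p: "p b > - 1" if "b \<in> Basis" for b
    using that by (cases b rule: Basis_cases) (use a \<kappa> in \<open>auto simp: p_x p_y\<close>)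
  define \<delta> where "\<delta> = \<epsilon> / real CARD('a)"
  have \<delta>: "\<delta> > 0" "\<delta> \<le> \<epsilon>" using \<epsilon> by (auto simp: \<delta>_def field_simps)
  define G :: "(real^'a) \<times> (real^'b::{finite,linorder}) \<Rightarrow> real" where
    "G z = (\<Prod>b\<in>Basis. \<bar>z \<bullet> b\<bar> powr p b * exp (- \<delta> * \<bar>z \<bullet> b\<bar>))" for z
  define \<phi> :: "(real^'a) \<times> (real^'b::{finite,linorder}) \<Rightarrow> real" where "\<phi> z = ysum' (snd z) - norm (fst z)" for z
  have [measurable]: "\<phi> \<in> borel_measurable borel"
    unfolding \<phi>_def by (intro borel_measurable_continuous_onI continuous_intros)
  have G_meas[measurable]: "G \<in> borel_measurable borel" unfolding G_def by measurable
  have "(\<integral>\<^sup>+z. ennreal (G (z + \<phi> z *\<^sub>R dir_y last_ix)) \<partial>lborel) = (\<integral>\<^sup>+z. ennreal (G z) \<partial>lborel)"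
    by (rule nn_integral_shear[of "dir_y last_ix" \<phi> "\<lambda>z. ennreal (G z)"])
       (auto simp: dir_in_Basis \<phi>_def ysum'_add ysum'_scaleR ysum'_axis)
  also have "\<dots> < \<infinity>"
    unfolding G_def by (rule nn_integral_prod_powr_exp_finite[OF p \<delta>(1)])
  finally have fin: "(\<integral>\<^sup>+z. ennreal (G (z + \<phi> z *\<^sub>R dir_y last_ix)) \<partial>lborel) < \<infinity>" .
  have G_nonneg: "G z \<ge> 0" for z by (auto simp: G_def intro!: prod_nonneg)
  have intG: "integrable lborel (\<lambda>z. G (z + \<phi> z *\<^sub>R dir_y last_ix))"
    using fin G_nonneg by (intro integrableI_nonneg) auto
  have bound: "base_weight a \<kappa> z * exp (- \<epsilon> * decay z) \<le> G (z + \<phi> z *\<^sub>R dir_y last_ix)"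
    if nz: "\<forall>b\<in>Basis. z \<bullet> b \<noteq> 0" for z
  proof (cases "z \<in> B_Sigma")
    case False
    then show ?thesis using G_nonneg by (simp add: base_weight_def)
  next
    case True
    define x y where "x = fst z" and "y = snd z"
    define \<tau> where "\<tau> = ysum y - norm x"
    have \<tau>: "\<tau> \<ge> 0" using height_ge_norm[OF True] by (simp add: \<tau>_def x_def y_def)
    have y0: "y $ j \<ge> 0" if "j \<noteq> last_ix" for j using True that by (simp add: mem_B_Sigma_iff y_def)
    have xi: "x $ i \<noteq> 0" for i
      using nz[rule_format, OF dir_in_Basis(1)[of i]] by (simp only: inner_dir x_def not_False_eq_True)
    then have x0: "\<bar>x $ i0\<bar> > 0" by simp
    have "(ysum y)\<^sup>2 - (norm x)\<^sup>2 = \<tau> * (\<tau> + 2 * norm x)"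
      by (simp add: \<tau>_def power2_eq_square algebra_simps)
    then have "((ysum y)\<^sup>2 - (norm x)\<^sup>2) powr a = \<tau> powr a * (\<tau> + 2 * norm x) powr a"
      using \<tau> by (simp add: powr_mult)
    also have "\<dots> \<le> \<tau> powr a * \<bar>x $ i0\<bar> powr a"
      using a x0 \<tau> component_le_norm_cart[of x i0] by (intro mult_left_mono powr_mono2') auto
    finally have w1: "((ysum y)\<^sup>2 - (norm x)\<^sup>2) powr a \<le> \<tau> powr a * \<bar>x $ i0\<bar> powr a" .
    have "\<delta> * (\<Sum>i\<in>UNIV. \<bar>x $ i\<bar>) \<le> \<delta> * (\<Sum>i\<in>(UNIV::'a set). norm x)"
      using \<delta> by (intro mult_left_mono sum_mono component_le_norm_cart) auto
    also have "\<dots> = \<epsilon> * norm x" by (simp add: \<delta>_def)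
    finally have ex: "\<delta> * (\<Sum>i\<in>UNIV. \<bar>x $ i\<bar>) \<le> \<epsilon> * norm x" .
    have "\<delta> * (\<Sum>j\<in>UNIV - {last_ix}. \<bar>y $ j\<bar>) = \<delta> * ysum' y"
      unfolding ysum'_def using y0 by (intro arg_cong[of _ _ "(*) \<delta>"] sum.cong) auto
    also have "\<dots> \<le> \<epsilon> * ysum' y" using \<delta> ysum'_nonneg[OF True] by (simp add: mult_right_mono y_def)
    finally have ey: "\<delta> * (\<Sum>j\<in>UNIV - {last_ix}. \<bar>y $ j\<bar>) \<le> \<epsilon> * ysum' y" .
    have et: "\<delta> * \<tau> \<le> \<epsilon> * \<tau>" using \<delta> \<tau> by (simp add: mult_right_mono)
    have dec: "\<epsilon> * decay z = \<epsilon> * norm x + \<epsilon> * ysum' y + \<epsilon> * \<tau>"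
      by (simp add: decay_def x_def y_def \<tau>_def algebra_simps)
    have expo: "exp (- \<epsilon> * decay z) \<le> exp (- \<delta> * (\<Sum>i\<in>UNIV. \<bar>x $ i\<bar>)) *
        (exp (- \<delta> * (\<Sum>j\<in>UNIV - {last_ix}. \<bar>y $ j\<bar>)) * exp (- \<delta> * \<tau>))"
      using ex ey et dec by (simp flip: exp_add)
    let ?z = "z + \<phi> z *\<^sub>R dir_y last_ix"
    have fz: "fst ?z = x" by (simp add: x_def)
    have sz: "snd ?z $ j = (if j = last_ix then \<tau> else y $ j)" for j
      using ysum_eq[of y] by (auto simp: \<phi>_def x_def y_def \<tau>_def axis_def)
    have Gz: "G ?z = (\<bar>x $ i0\<bar> powr a * exp (- \<delta> * (\<Sum>i\<in>UNIV. \<bar>x $ i\<bar>))) *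
       ((\<tau> powr a * exp (- \<delta> * \<tau>)) * ((\<Prod>j\<in>UNIV - {last_ix}. y $ j powr \<kappa> j) *
          exp (- \<delta> * (\<Sum>j\<in>UNIV - {last_ix}. \<bar>y $ j\<bar>))))"
    proof -
      have 1: "(\<Prod>i\<in>UNIV. \<bar>x $ i\<bar> powr p (dir_x i)) = \<bar>x $ i0\<bar> powr a"
      proof -
        have "(\<Prod>i\<in>UNIV. \<bar>x $ i\<bar> powr p (dir_x i)) = (\<Prod>i\<in>UNIV. if i = i0 then \<bar>x $ i\<bar> powr a else 1)"
          using xi by (intro prod.cong) (auto simp: p_x)
        then show ?thesis by simp
      qed
      have 2: "(\<Prod>j\<in>UNIV. F j (snd ?z $ j)) = F last_ix \<tau> * (\<Prod>j\<in>UNIV - {last_ix}. F j (y $ j))"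
        for F :: "'b \<Rightarrow> real \<Rightarrow> real"
        unfolding sz by (subst prod.remove[of UNIV last_ix]) (auto intro!: prod.cong)
      have 3: "(\<Prod>j\<in>UNIV - {last_ix}. \<bar>y $ j\<bar> powr \<kappa> j) = (\<Prod>j\<in>UNIV - {last_ix}. y $ j powr \<kappa> j)"
        using y0 by (intro prod.cong) auto
      show ?thesis
        unfolding G_def prod_Basis_pair inner_dir fz 2[of "\<lambda>j t. \<bar>t\<bar> powr p (dir_y j) * exp (- \<delta> * \<bar>t\<bar>)"]
        using \<tau> by (simp add: prod.distrib 1 3 p_y sum_distrib_left sum_negf[symmetric] flip: exp_sum)
    qed
    have "base_weight a \<kappa> z * exp (- \<epsilon> * decay z)
        = ((ysum y)\<^sup>2 - (norm x)\<^sup>2) powr a * (\<Prod>j\<in>UNIV - {last_ix}. y $ j powr \<kappa> j) * exp (- \<epsilon> * decay z)"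
      using True by (simp add: base_weight_def x_def y_def)
    also have "\<dots> \<le> (\<tau> powr a * \<bar>x $ i0\<bar> powr a) * (\<Prod>j\<in>UNIV - {last_ix}. y $ j powr \<kappa> j) *
      (exp (- \<delta> * (\<Sum>i\<in>UNIV. \<bar>x $ i\<bar>)) *
        (exp (- \<delta> * (\<Sum>j\<in>UNIV - {last_ix}. \<bar>y $ j\<bar>)) * exp (- \<delta> * \<tau>)))"
      by (intro mult_mono w1 expo order_refl mult_nonneg_nonneg prod_nonneg) auto
    also have "\<dots> = G ?z" unfolding Gz by (simp only: mult_ac)
    finally show ?thesis .
  qed
  show ?thesis
  proof (rule Bochner_Integration.integrable_bound[OF intG])
    have "decay \<in> borel_measurable (borel :: ((real^'a) \<times> (real^'b::{finite,linorder})) measure)" by (rule linear_imp_borel[OF linear_decay])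
    then show "(\<lambda>z :: (real^'a) \<times> (real^'b::{finite,linorder}). base_weight a \<kappa> z * exp (- \<epsilon> * decay z)) \<in> borel_measurable lborel"
      by measurable
    show "AE z in lborel. norm (base_weight a \<kappa> z * exp (- \<epsilon> * decay z))
        \<le> norm (G (z + \<phi> z *\<^sub>R dir_y last_ix))"
      using AE_lborel_coordinates_nonzero
    proof eventually_elim
      case (elim z)
      from bound[OF elim] show ?case
        using G_nonneg base_weight_nonneg[of a \<kappa> z] by (simp add: abs_mult)
    qed
  qed
qed

text \<open>
  A positive power of the cone factor is at most a power of \<open>|y|\<close>, which half of the exponential absorbs.
\<close>

lemma base_weight_integrable:
  fixes \<kappa> :: "'b::{finite,linorder} \<Rightarrow> real"
  assumes a: "a > - 1" and \<kappa>: "\<And>i. i \<noteq> last_ix \<Longrightarrow> \<kappa> i > - 1" and \<epsilon>: "\<epsilon> > 0"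
  shows "integrable lborel (\<lambda>z :: (real^'a) \<times> (real^'b::{finite,linorder}). base_weight a \<kappa> z * exp (- \<epsilon> * decay z))"
proof (cases "a \<le> 0")
  case True
  then show ?thesis by (intro base_weight_integrable_nonpos a \<kappa> \<epsilon>)
next
  case False
  define C where "C = (2 * a / (\<epsilon> / 2)) powr (2 * a)"
  show ?thesis
  proof (rule Bochner_Integration.integrable_bound)
    show "integrable lborel (\<lambda>z :: (real^'a) \<times> (real^'b::{finite,linorder}). C * (base_weight 0 \<kappa> z * exp (- (\<epsilon> / 2) * decay z)))"
      using \<epsilon> by (intro integrable_mult_right base_weight_integrable_nonpos \<kappa>) auto
    have "decay \<in> borel_measurable (borel :: ((real^'a) \<times> (real^'b::{finite,linorder})) measure)" by (rule linear_imp_borel[OF linear_decay])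
    then show "(\<lambda>z :: (real^'a) \<times> (real^'b::{finite,linorder}). base_weight a \<kappa> z * exp (- \<epsilon> * decay z)) \<in> borel_measurable lborel"
      by measurable
    have "base_weight a \<kappa> z * exp (- \<epsilon> * decay z)
        \<le> C * (base_weight 0 \<kappa> z * exp (- (\<epsilon> / 2) * decay z))" for z :: "(real^'a) \<times> (real^'b::{finite,linorder})"
    proof (cases "z \<in> B_Sigma \<and> (height z)\<^sup>2 - (norm (fst z))\<^sup>2 \<noteq> 0")
      case True
      let ?q = "(height z)\<^sup>2 - (norm (fst z))\<^sup>2" and ?\<Pi> = "\<Prod>i\<in>UNIV - {last_ix}. (snd z $ i) powr \<kappa> i"
      have T: "height z \<ge> 0" "height z \<le> decay z"
        using True height_nonneg[of z] ysum'_nonneg[of z] by (simp_all add: decay_def)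
      have "?q \<ge> 0" using height_ge_norm[of z] True by (simp add: power_mono)
      then have "?q powr a \<le> ((height z)\<^sup>2) powr a"
        using False by (intro powr_mono2) auto
      also have "\<dots> = height z powr (2 * a)"
        using T by (simp add: powr_powr flip: powr_numeral)
      also have "\<dots> \<le> C * exp (\<epsilon> / 2 * height z)"
        unfolding C_def using T False \<epsilon> by (intro powr_le_exp) auto
      also have "\<dots> \<le> C * exp (\<epsilon> / 2 * decay z)"
        using T \<epsilon> by (intro mult_left_mono) (auto simp: C_def)
      finally have "?q powr a * ?\<Pi> * exp (- \<epsilon> * decay z) \<le> C * exp (\<epsilon> / 2 * decay z) * ?\<Pi> * exp (- \<epsilon> * decay z)"
        by (intro mult_right_mono) (auto intro!: prod_nonneg)
      also have "\<dots> = C * (?\<Pi> * (exp (\<epsilon> / 2 * decay z) * exp (- \<epsilon> * decay z)))"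
        by (simp only: mult_ac)
      also have "exp (\<epsilon> / 2 * decay z) * exp (- \<epsilon> * decay z) = exp (- (\<epsilon> / 2) * decay z)"
        by (simp add: algebra_simps flip: exp_add)
      finally show ?thesis using True by (simp add: base_weight_def)
    qed (auto simp: base_weight_def)
    then show "AE z in (lborel :: ((real^'a) \<times> (real^'b::{finite,linorder})) measure). norm (base_weight a \<kappa> z * exp (- \<epsilon> * decay z))
        \<le> norm (C * (base_weight 0 \<kappa> z * exp (- (\<epsilon> / 2) * decay z)))"
      by (intro AE_I2) (simp add: abs_mult base_weight_nonneg C_def)
  qed
qed

section \<open>The flows of the boosts, the dilation and the stretchings\<close>

text \<open>
  The field \<open>|y| \<partial>\<^bsub>x\<^sub>i\<^esub> + x\<^sub>i \<partial>\<^bsub>|y|\<^esub>\<close>, where the derivative with respect to \<open>|y|\<close> at fixed \<open>y'\<close> is that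
  with respect to \<open>y\<^sub>d\<close>.
\<close>

definition boost :: "'a \<Rightarrow> (real^'a) \<times> (real^'b::{finite,linorder}) \<Rightarrow> (real^'a) \<times> (real^'b::{finite,linorder})"
  where "boost i z = height z *\<^sub>R dir_x i + (fst z $ i) *\<^sub>R dir_y last_ix"

text \<open>
  The radial field of \<open>(x, |y|)\<close> at fixed \<open>y'\<close>.
\<close>

definition dilation :: "(real^'a) \<times> (real^'b::{finite,linorder}) \<Rightarrow> (real^'a) \<times> (real^'b::{finite,linorder})"
  where "dilation z = (fst z, 0) + height z *\<^sub>R dir_y last_ix"

text \<open>
  The radial field of the single coordinate \<open>y\<^sub>j\<close> at fixed \<open>|y|\<close>: the last coordinate compensates.
\<close>

definition stretch :: "'b::{finite,linorder} \<Rightarrow> (real^'a) \<times> (real^'b::{finite,linorder}) \<Rightarrow> (real^'a) \<times> (real^'b::{finite,linorder})"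
  where "stretch i z = (snd z $ i) *\<^sub>R (dir_y i - dir_y last_ix)"

lemma linear_fields: "linear (boost i)" "linear dilation" "linear (stretch j)"
  by (rule linearI;
      simp add: boost_def dilation_def stretch_def ysum_add ysum_scaleR algebra_simps scaleR_prod_def
        plus_prod_def vec_eq_iff)+

lemma scaleR_axis: "c *\<^sub>R axis i x = axis i (c * x)" for c x :: real
  by (simp add: axis_def vec_eq_iff)

lemma axis_component: "axis i x $ j = (if j = i then x else 0)"
  by (simp add: axis_def)

lemma axis_add: "axis i x + axis i y = axis i (x + y)" for x y :: real
  by (simp add: axis_def vec_eq_iff)

lemma boost_simps:
  "height (boost i z) = fst z $ i" "fst (boost i z) = axis i (height z)"
  "snd (boost i z) = axis last_ix (fst z $ i)"
  by (simp_all add: boost_def ysum_axis scaleR_axis)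

lemma dilation_simps:
  "height (dilation z) = height z" "fst (dilation z) = fst z" "snd (dilation z) = axis last_ix (height z)"
  by (simp_all add: dilation_def ysum_axis scaleR_axis)

lemma stretch_simps:
  "height (stretch i z) = 0" "fst (stretch i z) = 0"
  "snd (stretch i z) = axis i (snd z $ i) - axis last_ix (snd z $ i)"
proof -
  have "ysum (axis i (1::real) - axis last_ix 1) = 0"
    using ysum_add[of "axis i 1 - axis last_ix 1" "axis last_ix 1"] by (simp add: ysum_axis)
  then show "height (stretch i z) = 0" by (simp add: stretch_def ysum_scaleR)
qed (simp_all add: stretch_def axis_def vec_eq_iff)

lemma boost_cubic: "boost i (boost i (boost i z)) = boost i z"
  by (simp add: prod_eq_iff boost_simps ysum_axis)

lemma dilation_idem: "dilation (dilation z) = dilation z"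
  by (simp add: prod_eq_iff dilation_simps ysum_axis)

lemma stretch_idem: "i \<noteq> last_ix \<Longrightarrow> stretch i (stretch i z) = stretch i z"
  by (simp add: prod_eq_iff stretch_simps) (simp add: axis_def)


lemma boost_flow:
  "fst (cubic_flow (boost i) s z) = fst z + axis i (sinh s * height z + (cosh s - 1) * fst z $ i)"
  "snd (cubic_flow (boost i) s z) = snd z + axis last_ix (sinh s * fst z $ i + (cosh s - 1) * height z)"
  by (simp_all add: cubic_flow_def boost_simps ysum_axis scaleR_axis axis_add add.assoc)

lemma norm_sq_add_axis: "(norm (x + axis i c))\<^sup>2 = (norm x)\<^sup>2 - (x $ i)\<^sup>2 + (x $ i + c)\<^sup>2" for x :: "real^'a"
proof -
  have "(norm (x + axis i c))\<^sup>2 = (norm x)\<^sup>2 + 2 * (x \<bullet> axis i c) + (norm (axis i c))\<^sup>2"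
    by (simp add: power2_norm_eq_inner inner_add inner_commute)
  moreover have "(norm (axis i c))\<^sup>2 = c\<^sup>2"
    by (simp only: power2_norm_eq_inner inner_axis_axis) (simp add: power2_eq_square)
  ultimately show ?thesis by (simp add: inner_axis power2_eq_square algebra_simps)
qed

text \<open>
  The flow is a Lorentz boost in the plane of \<open>x\<^sub>i\<close> and \<open>|y|\<close>.
\<close>

lemma boost_flow_form:
  "(height (cubic_flow (boost i) s z))\<^sup>2 - (norm (fst (cubic_flow (boost i) s z)))\<^sup>2
    = (height z)\<^sup>2 - (norm (fst z))\<^sup>2"
proof -
  let ?t = "height z" and ?x = "fst z $ i"
  have "height (cubic_flow (boost i) s z) = cosh s * ?t + sinh s * ?x"
    by (simp add: boost_flow ysum_add ysum_axis algebra_simps)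
  moreover have "?x + (sinh s * ?t + (cosh s - 1) * ?x) = cosh s * ?x + sinh s * ?t"
    by (simp add: algebra_simps)
  moreover have "(cosh s * ?t + sinh s * ?x)\<^sup>2 - (cosh s * ?x + sinh s * ?t)\<^sup>2
      = ((cosh s)\<^sup>2 - (sinh s)\<^sup>2) * (?t\<^sup>2 - ?x\<^sup>2)"
    by (simp add: power2_eq_square algebra_simps)
  ultimately show ?thesis
    using cosh_square_eq[of s] by (simp only: boost_flow(1) norm_sq_add_axis) simp
qed

lemma abs_sinh_le_cosh: "\<bar>sinh s\<bar> \<le> cosh s" for s :: real
  by (rule abs_le_square_iff[THEN iffD2, of "sinh s" "cosh s", simplified]) (simp add: cosh_square_eq)

lemma boost_flow_mem:
  assumes "z \<in> B_Sigma"
  shows "cubic_flow (boost i) s z \<in> B_Sigma"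
proof -
  let ?z = "cubic_flow (boost i) s z"
  have x: "\<bar>fst z $ i\<bar> \<le> height z" using component_le_norm_cart[of "fst z" i] height_ge_norm[OF assms] by linarith
  have "\<bar>sinh s * fst z $ i\<bar> \<le> cosh s * height z"
    unfolding abs_mult using x abs_sinh_le_cosh[of s] by (intro mult_mono) auto
  moreover have "height ?z = cosh s * height z + sinh s * fst z $ i"
    by (simp add: boost_flow ysum_add ysum_axis algebra_simps)
  ultimately have "height ?z \<ge> 0" by linarith
  moreover have "(norm (fst ?z))\<^sup>2 \<le> (height ?z)\<^sup>2"
    using boost_flow_form[of i s z] power_mono[OF height_ge_norm[OF assms] norm_ge_zero, of 2] by linarith
  ultimately have "norm (fst ?z) \<le> height ?z" by (rule power2_le_imp_le[rotated])
  then show ?thesis using assms by (auto simp: mem_B_Sigma_iff boost_flow axis_def)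
qed

lemma boost_flow_weight: "base_weight a \<kappa> (cubic_flow (boost i) s z) = base_weight a \<kappa> z"
proof -
  have "(cubic_flow (boost i) s z \<in> B_Sigma) = (z \<in> B_Sigma)"
    by (intro cubic_flow_mem_iff linear_fields boost_cubic boost_flow_mem)
  moreover have "snd (cubic_flow (boost i) s z) $ j = snd z $ j" if "j \<noteq> last_ix" for j
    using that by (simp add: boost_flow axis_def)
  ultimately show ?thesis
    unfolding base_weight_def boost_flow_form by (simp add: indicator_def)
qed

text \<open>
  A hyperbolic rotation of the plane is the product of three shears, of slopes \<open>tanh (s/2)\<close>, \<open>sinh s\<close>
  and \<open>tanh (s/2)\<close>.
\<close>

lemma boost_flow_volume:
  assumes "s > 0"
  shows "scales_lborel (cubic_flow (boost i) s :: (real^'a) \<times> (real^'b::{finite,linorder}) \<Rightarrow> _) 1"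
proof -
  \<comment> \<open>This is \<open>tanh (s/2)\<close>.\<close>
  define \<alpha> where "\<alpha> = (cosh s - 1) / sinh s"
  have "sinh s > 0" using assms by simp
  then have \<alpha>: "sinh s * \<alpha> = cosh s - 1" by (simp add: \<alpha>_def)
  have "sinh s * (\<alpha> * (cosh s + 1)) = (sinh s * \<alpha>) * (cosh s + 1)"
    by (simp only: mult.assoc)
  also have "\<dots> = (cosh s)\<^sup>2 - 1"
    unfolding \<alpha> by (simp add: power2_eq_square algebra_simps)
  also have "\<dots> = sinh s * sinh s"
    using cosh_square_eq[of s] by (simp add: power2_eq_square)
  finally have \<alpha>': "\<alpha> * (cosh s + 1) = sinh s" using \<open>sinh s > 0\<close> by simp
  let ?S = "\<lambda>z. z + (\<alpha> * fst z $ i) *\<^sub>R dir_y last_ix :: (real^'a) \<times> (real^'b::{finite,linorder})"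
  let ?R = "\<lambda>z. z + (sinh s * height z) *\<^sub>R dir_x i :: (real^'a) \<times> (real^'b::{finite,linorder})"
  have meas: "(\<lambda>z. \<alpha> * fst z $ i) \<in> borel_measurable (borel :: ((real^'a) \<times> (real^'b::{finite,linorder})) measure)"
    "(\<lambda>z. sinh s * height z) \<in> borel_measurable (borel :: ((real^'a) \<times> (real^'b::{finite,linorder})) measure)"
    by (intro borel_measurable_continuous_onI continuous_intros)+
  have S: "scales_lborel ?S 1" by (rule scales_lborel_shear[OF dir_in_Basis(2) meas(1)]) simp
  have R: "scales_lborel ?R 1" by (rule scales_lborel_shear[OF dir_in_Basis(1) meas(2)]) simp
  have "scales_lborel (\<lambda>z. ?S (?R (?S z))) 1"
    using scales_lborel_compose[OF scales_lborel_compose[OF S R] S] by simp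
  also have "(\<lambda>z. ?S (?R (?S z))) = cubic_flow (boost i) s"
  proof
    fix z :: "(real^'a) \<times> (real^'b::{finite,linorder})"
    let ?t = "height z" and ?x = "fst z $ i"
    have "sinh s * (?t + \<alpha> * ?x) = sinh s * ?t + (sinh s * \<alpha>) * ?x"
      by (simp add: algebra_simps)
    then have 1: "sinh s * (?t + \<alpha> * ?x) = sinh s * ?t + (cosh s - 1) * ?x"
      by (simp only: \<alpha>)
    have "\<alpha> * ?x + \<alpha> * (?x + sinh s * (?t + \<alpha> * ?x)) = (sinh s * \<alpha>) * ?t + (\<alpha> * (cosh s + 1)) * ?x"
      unfolding 1 by (simp add: algebra_simps)
    then have 2: "\<alpha> * ?x + \<alpha> * (?x + sinh s * (?t + \<alpha> * ?x)) = sinh s * ?x + (cosh s - 1) * ?t"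
      unfolding \<alpha> \<alpha>' by (simp only: add.commute)
    have x: "fst (?S (?R (?S z))) = fst z + axis i (sinh s * (?t + \<alpha> * ?x))"
      by (simp add: scaleR_axis ysum_add ysum_axis)
    have y: "snd (?S (?R (?S z))) = snd z + axis last_ix (\<alpha> * ?x + \<alpha> * (?x + sinh s * (?t + \<alpha> * ?x)))"
      by (simp add: scaleR_axis axis_add ysum_add ysum_axis add.assoc)
    show "?S (?R (?S z)) = cubic_flow (boost i) s z"
      by (simp only: prod_eq_iff boost_flow x[unfolded 1] y[unfolded 2])
  qed
  finally show ?thesis .
qed


lemma dilation_flow:
  "fst (cubic_flow dilation s z) = exp s *\<^sub>R fst z"
  "snd (cubic_flow dilation s z) = snd z + axis last_ix ((exp s - 1) * height z)"
  by (simp_all add: cubic_flow_idempotent dilation_idem dilation_simps scaleR_axis)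
     (simp add: scaleR_diff_left)

lemma stretch_flow:
  assumes "i \<noteq> last_ix"
  shows "fst (cubic_flow (stretch i) s z) = fst z"
    "snd (cubic_flow (stretch i) s z) = snd z + axis i ((exp s - 1) * snd z $ i) - axis last_ix ((exp s - 1) * snd z $ i)"
  using assms by (simp_all add: cubic_flow_idempotent stretch_idem stretch_simps scaleR_axis scaleR_diff_right)

lemma dilation_flow_height: "height (cubic_flow dilation s z) = exp s * height z"
  by (simp add: dilation_flow ysum_add ysum_axis algebra_simps)

lemma stretch_flow_height: "i \<noteq> last_ix \<Longrightarrow> height (cubic_flow (stretch i) s z) = height z"
  using linear_height by (simp add: cubic_flow_idempotent stretch_idem ysum_add ysum_scaleR stretch_simps(1))

lemma dilation_flow_weight:
  "base_weight a \<kappa> (cubic_flow dilation s z) = exp (2 * a * s) * base_weight a \<kappa> z"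
proof -
  have "cubic_flow dilation s z \<in> B_Sigma" if "z \<in> B_Sigma" for s and z :: "(real^'c) \<times> (real^'d::{finite,linorder})"
    using that by (auto simp: mem_B_Sigma_iff dilation_flow_height) (auto simp: dilation_flow axis_def)
  then have "(cubic_flow dilation s z \<in> B_Sigma) = (z \<in> B_Sigma)"
    by (intro cubic_flow_mem_iff linear_fields) (simp_all add: dilation_idem)
  moreover have "snd (cubic_flow dilation s z) $ j = snd z $ j" if "j \<noteq> last_ix" for j
    using that by (simp add: dilation_flow axis_def)
  moreover have "((height (cubic_flow dilation s z))\<^sup>2 - (norm (fst (cubic_flow dilation s z)))\<^sup>2) powr a
      = exp (2 * a * s) * ((height z)\<^sup>2 - (norm (fst z))\<^sup>2) powr a"
  proof -
    have "(height (cubic_flow dilation s z))\<^sup>2 - (norm (fst (cubic_flow dilation s z)))\<^sup>2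
        = exp (2 * s) * ((height z)\<^sup>2 - (norm (fst z))\<^sup>2)"
      by (simp add: dilation_flow_height dilation_flow(1) power_mult_distrib right_diff_distrib exp_double)
    then show ?thesis by (simp add: powr_mult exp_powr_real mult_ac)
  qed
  ultimately show ?thesis
    unfolding base_weight_def by (simp add: indicator_def)
qed

lemma stretch_flow_weight:
  fixes \<kappa> :: "'b::{finite,linorder} \<Rightarrow> real"
  assumes i: "i \<noteq> last_ix"
  shows "base_weight a \<kappa> (cubic_flow (stretch i) s z) = exp (\<kappa> i * s) * base_weight a \<kappa> z"
proof -
  have y: "snd (cubic_flow (stretch i) s z) $ j = (if j = i then exp s else 1) * snd z $ j"
    if "j \<noteq> last_ix" for j s and z :: "(real^'c) \<times> (real^'b::{finite,linorder})"
    using that i by (auto simp: stretch_flow axis_def algebra_simps)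
  have "cubic_flow (stretch i) s z \<in> B_Sigma" if "z \<in> B_Sigma" for s and z :: "(real^'c) \<times> (real^'b::{finite,linorder})"
    using that by (auto simp: mem_B_Sigma_iff stretch_flow_height[OF i] stretch_flow(1)[OF i] y)
  then have "(cubic_flow (stretch i) s z \<in> B_Sigma) = (z \<in> B_Sigma)"
    by (intro cubic_flow_mem_iff linear_fields) (simp_all add: stretch_idem i)
  moreover have "(\<Prod>j\<in>UNIV - {last_ix}. (snd (cubic_flow (stretch i) s z) $ j) powr \<kappa> j)
      = exp (\<kappa> i * s) * (\<Prod>j\<in>UNIV - {last_ix}. (snd z $ j) powr \<kappa> j)"
  proof -
    have "(\<Prod>j\<in>UNIV - {last_ix}. (snd (cubic_flow (stretch i) s z) $ j) powr \<kappa> j)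
      = (\<Prod>j\<in>UNIV - {last_ix}. (if j = i then exp (\<kappa> i * s) else 1) * (snd z $ j) powr \<kappa> j)"
      by (intro prod.cong) (auto simp: y powr_mult exp_powr_real mult.commute)
    also have "\<dots> = (\<Prod>j\<in>UNIV - {last_ix}. if j = i then exp (\<kappa> i * s) else 1) * (\<Prod>j\<in>UNIV - {last_ix}. (snd z $ j) powr \<kappa> j)"
      by (rule prod.distrib)
    also have "(\<Prod>j\<in>UNIV - {last_ix}. if j = i then exp (\<kappa> i * s) else 1) = exp (\<kappa> i * s)"
      using i by simp
    finally show ?thesis .
  qed
  ultimately show ?thesis
    unfolding base_weight_def by (simp add: indicator_def stretch_flow_height[OF i] stretch_flow(1)[OF i])
qed

lemma diagonal_components:
  fixes c :: "(real^'a) \<times> (real^'b) \<Rightarrow> real"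
  shows "fst (\<Sum>b\<in>Basis. (c b * (z \<bullet> b)) *\<^sub>R b) $ i = c (dir_x i) * fst z $ i"
    "snd (\<Sum>b\<in>Basis. (c b * (z \<bullet> b)) *\<^sub>R b) $ j = c (dir_y j) * snd z $ j"
  unfolding inner_dir[symmetric] by (simp_all only: inner_sum_left_Basis dir_in_Basis)

text \<open>
  The diagonal part scales \<open>x\<close> and \<open>y\<^sub>d\<close>; the shear adds the multiple of \<open>|y'|\<close> that is missing for \<open>|y|\<close>
  to be scaled.
\<close>

lemma dilation_flow_volume:
  "scales_lborel (cubic_flow dilation s :: (real^'a) \<times> (real^'b::{finite,linorder}) \<Rightarrow> _)
    (exp (- (real CARD('a) + 1) * s))"
proof -
  define c :: "(real^'a) \<times> (real^'b::{finite,linorder}) \<Rightarrow> real"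
    where "c b = (if snd b = 0 \<or> b = dir_y last_ix then exp s else 1)" for b
  let ?D = "\<lambda>z. \<Sum>b\<in>Basis. (c b * (z \<bullet> b)) *\<^sub>R b"
  let ?S = "\<lambda>z. z + ((exp s - 1) * ysum' (snd z)) *\<^sub>R dir_y last_ix :: (real^'a) \<times> (real^'b::{finite,linorder})"
  have c: "c (dir_x i) = exp s" "c (dir_y j) = (if j = last_ix then exp s else 1)" for i j
    by (auto simp: c_def axis_eq_0_iff axis_eq_axis)
  have "scales_lborel ?D (inverse (\<Prod>b\<in>Basis. c b))"
    by (rule scales_lborel_diagonal) (simp add: c_def)
  moreover have "(\<Prod>b\<in>Basis. c b) = exp ((real CARD('a) + 1) * s)"
    unfolding prod_Basis_pair c by (simp add: exp_of_nat_mult[symmetric] distrib_right exp_add)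
  ultimately have D: "scales_lborel ?D (exp (- (real CARD('a) + 1) * s))"
    by (simp add: exp_minus[symmetric] algebra_simps)
  have S: "scales_lborel ?S 1"
    by (rule scales_lborel_shear[OF dir_in_Basis(2)])
       (auto simp: ysum'_add ysum'_scaleR ysum'_axis intro!: borel_measurable_continuous_onI continuous_intros)
  have "?S (?D z) = cubic_flow dilation s z" for z
  proof -
    have "fst (?S (?D z)) = fst (cubic_flow dilation s z)"
      by (simp add: vec_eq_iff diagonal_components c dilation_flow)
    moreover have "ysum' (snd (?D z)) = ysum' (snd z)"
      unfolding ysum'_def by (intro sum.cong) (auto simp: diagonal_components c)
    then have "snd (?S (?D z)) = snd (cubic_flow dilation s z)"
      by (auto simp: vec_eq_iff diagonal_components c dilation_flow axis_component ysum_eq algebra_simps)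
    ultimately show ?thesis by (simp only: prod_eq_iff)
  qed
  with scales_lborel_compose[OF D S] show ?thesis by simp
qed

text \<open>
  The diagonal part scales \<open>y\<^sub>j\<close>; the shear restores the value of \<open>|y|\<close>.
\<close>

lemma stretch_flow_volume:
  assumes i: "i \<noteq> last_ix"
  shows "scales_lborel (cubic_flow (stretch i) s :: (real^'a) \<times> (real^'b::{finite,linorder}) \<Rightarrow> _) (exp (- 1 * s))"
proof -
  define c :: "(real^'a) \<times> (real^'b::{finite,linorder}) \<Rightarrow> real"
    where "c b = (if b = dir_y i then exp s else 1)" for b
  let ?D = "\<lambda>z. \<Sum>b\<in>Basis. (c b * (z \<bullet> b)) *\<^sub>R b"
  let ?S = "\<lambda>z. z + (- (1 - exp (- s)) * snd z $ i) *\<^sub>R dir_y last_ix :: (real^'a) \<times> (real^'b::{finite,linorder})"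
  have c: "c (dir_x k) = 1" "c (dir_y j) = (if j = i then exp s else 1)" for k j
    by (auto simp: c_def axis_eq_0_iff axis_eq_axis)
  have "scales_lborel ?D (inverse (\<Prod>b\<in>Basis. c b))"
    by (rule scales_lborel_diagonal) (simp add: c_def)
  then have D: "scales_lborel ?D (exp (- 1 * s))"
    unfolding prod_Basis_pair c by (simp add: exp_minus)
  have S: "scales_lborel ?S 1"
    using i by (intro scales_lborel_shear[OF dir_in_Basis(2)])
       (auto simp: axis_component intro!: borel_measurable_continuous_onI continuous_intros)
  have "?S (?D z) = cubic_flow (stretch i) s z" for z
  proof -
    have "fst (?S (?D z)) = fst (cubic_flow (stretch i) s z)"
      using i by (simp add: vec_eq_iff diagonal_components c stretch_flow)
    moreover have "snd (?S (?D z)) = snd (cubic_flow (stretch i) s z)"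
      using i by (auto simp: vec_eq_iff diagonal_components c stretch_flow axis_component algebra_simps simp flip: exp_add)
    ultimately show ?thesis by (simp only: prod_eq_iff)
  qed
  with scales_lborel_compose[OF D S] show ?thesis by simp
qed


text \<open>
  The three instances of the vanishing of integrals along a flow. In each, the integrand is
  \<open>W\<^sup>-\<^sup>1 div (W g V)\<close> for a row \<open>V\<close> of the coefficient matrix of the operator.
\<close>

context
  fixes a :: real and \<kappa> :: "'b::{finite,linorder} \<Rightarrow> real"
  assumes a: "a > - 1" and \<kappa>: "\<And>i. i \<noteq> last_ix \<Longrightarrow> \<kappa> i > - 1"
begin

lemma boost_integral:
  fixes g :: "(real^'a) \<times> (real^'b::{finite,linorder}) \<Rightarrow> real"
  assumes g: "real_polynomial_function g"
  shows "(LINT z|lborel. (dir_deriv (boost i z) g z - fst z $ i * g z) * exp (- decay z) * base_weight a \<kappa> z) = 0"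
proof -
  have dec: "decay (boost i z) = fst z $ i" "decay (boost i (boost i z)) = height z"
    for z :: "(real^'a) \<times> (real^'b::{finite,linorder})"
    by (simp_all add: decay_def boost_simps ysum_axis ysum'_axis)
  have "(LINT z|lborel. (dir_deriv (boost i z) g z + (0 + 0 - decay (boost i z)) * g z) * exp (- decay z) * base_weight a \<kappa> z) = 0"
  proof (rule integral_along_flow_zero[where K = 3, OF linear_fields(1) boost_cubic linear_decay
        base_weight_borel base_weight_nonneg _ _ _ _ base_weight_integrable[OF a \<kappa>] _ _ g])
    fix z :: "(real^'a) \<times> (real^'b::{finite,linorder})" assume "base_weight a \<kappa> z \<noteq> 0"
    then have z: "z \<in> B_Sigma" by (rule base_weight_support)
    show "norm z \<le> 3 * decay z" by (rule norm_le_decay[OF z])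
    show "- decay z \<le> decay (boost i z)" unfolding dec(1)
      using component_le_norm_cart[of "fst z" i] height_ge_norm[OF z] ysum'_nonneg[OF z]
      by (simp add: decay_def)
    show "0 \<le> decay (boost i (boost i z))" unfolding dec(2) by (rule height_nonneg[OF z])
  qed (simp_all add: boost_flow_weight boost_flow_volume)
  then show ?thesis by (simp add: dec)
qed

lemma dilation_integral:
  fixes g :: "(real^'a) \<times> (real^'b::{finite,linorder}) \<Rightarrow> real"
  assumes g: "real_polynomial_function g"
  shows "(LINT z|lborel. (dir_deriv (dilation z) g z + (2 * a + (real CARD('a) + 1) - height z) * g z)
      * exp (- decay z) * base_weight a \<kappa> z) = 0"
proof -
  have dec: "decay (dilation z) = height z"
    for z :: "(real^'a) \<times> (real^'b::{finite,linorder})"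
    by (simp add: decay_def dilation_simps ysum_axis ysum'_axis)
  have "(LINT z|lborel. (dir_deriv (dilation z) g z + (2 * a + (real CARD('a) + 1) - decay (dilation z)) * g z)
      * exp (- decay z) * base_weight a \<kappa> z) = 0"
  proof (rule integral_along_flow_zero[where K = 3, OF linear_fields(2) _ linear_decay
        base_weight_borel base_weight_nonneg _ _ _ _ base_weight_integrable[OF a \<kappa>] dilation_flow_weight
        dilation_flow_volume g])
    fix z :: "(real^'a) \<times> (real^'b::{finite,linorder})" assume "base_weight a \<kappa> z \<noteq> 0"
    then have z: "z \<in> B_Sigma" by (rule base_weight_support)
    show "norm z \<le> 3 * decay z" by (rule norm_le_decay[OF z])
    show "- decay z \<le> decay (dilation z)" unfolding dec
      using height_nonneg[OF z] ysum'_nonneg[OF z] by (simp add: decay_def)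
    show "0 \<le> decay (dilation (dilation z))" unfolding dilation_idem dec by (rule height_nonneg[OF z])
  qed (simp_all add: dilation_idem)
  then show ?thesis by (simp add: dec)
qed

lemma stretch_integral:
  fixes g :: "(real^'a) \<times> (real^'b::{finite,linorder}) \<Rightarrow> real"
  assumes g: "real_polynomial_function g" and i: "i \<noteq> last_ix"
  shows "(LINT z|lborel. (dir_deriv (stretch i z) g z + (\<kappa> i + 1 - snd z $ i) * g z)
      * exp (- decay z) * base_weight a \<kappa> z) = 0"
proof -
  have dec: "decay (stretch i z) = snd z $ i"
    for z :: "(real^'a) \<times> (real^'b::{finite,linorder})"
    using i ysum'_add[of "axis i (snd z $ i) - axis last_ix (snd z $ i)" "axis last_ix (snd z $ i)"]
    by (simp add: decay_def stretch_simps(1)) (simp add: stretch_simps ysum'_axis)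
  have "(LINT z|lborel. (dir_deriv (stretch i z) g z + (\<kappa> i + 1 - decay (stretch i z)) * g z)
      * exp (- decay z) * base_weight a \<kappa> z) = 0"
  proof (rule integral_along_flow_zero[where K = 3, OF linear_fields(3) _ linear_decay
        base_weight_borel base_weight_nonneg _ _ _ _ base_weight_integrable[OF a \<kappa>] stretch_flow_weight[OF i]
        stretch_flow_volume[OF i] g])
    fix z :: "(real^'a) \<times> (real^'b::{finite,linorder})" assume "base_weight a \<kappa> z \<noteq> 0"
    then have z: "z \<in> B_Sigma" by (rule base_weight_support)
    then have "snd z $ i \<ge> 0" using i by (simp add: mem_B_Sigma_iff)
    then show "- decay z \<le> decay (stretch i z)" "0 \<le> decay (stretch i (stretch i z))"
      unfolding stretch_idem[OF i] dec
      using height_nonneg[OF z] ysum'_nonneg[OF z] by (simp_all add: decay_def)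
    show "norm z \<le> 3 * decay z" by (rule norm_le_decay[OF z])
  qed (simp_all add: stretch_idem[OF i])
  then show ?thesis by (simp add: dec)
qed

end

section \<open>The operator in divergence form\<close>

definition weighted_integral ::
  "real \<Rightarrow> ('b::{finite,linorder} \<Rightarrow> real) \<Rightarrow> ((real^'a) \<times> (real^'b::{finite,linorder}) \<Rightarrow> real) \<Rightarrow> real"
  where "weighted_integral a \<kappa> p = (LINT z|lborel. p z * exp (- decay z) * base_weight a \<kappa> z)"

lemma W_B_Sigma_eq:
  "indicator B_Sigma z * W_B_Sigma \<mu> \<kappa> z = exp (- decay z) * base_weight (\<mu> - 1/2) \<kappa> z"
  by (cases z) (simp add: W_B_Sigma_def base_weight_def decay_def)

lemma set_integral_B_Sigma:
  "(LINT z:B_Sigma|lborel. p z * W_B_Sigma \<mu> \<kappa> z) = weighted_integral (\<mu> - 1/2) \<kappa> p"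
proof -
  have "indicator B_Sigma z *\<^sub>R (p z * W_B_Sigma \<mu> \<kappa> z) = p z * exp (- decay z) * base_weight (\<mu> - 1/2) \<kappa> z" for z
    using W_B_Sigma_eq[of z \<mu> \<kappa>] by (simp add: mult.assoc mult.left_commute[of _ "p z"])
  then show ?thesis
    unfolding weighted_integral_def set_lebesgue_integral_def by (simp only:)
qed

lemma bounded_linear_height: "bounded_linear height"
  using linear_height by (simp add: linear_conv_bounded_linear)

lemma bounded_linear_coordinates:
  "bounded_linear (\<lambda>z :: (real^'a) \<times> (real^'b). fst z $ i)"
  "bounded_linear (\<lambda>z :: (real^'a) \<times> (real^'b). snd z $ j)"
  using bounded_linear_compose[OF bounded_linear_vec_nth bounded_linear_fst]
    bounded_linear_compose[OF bounded_linear_vec_nth bounded_linear_snd] by auto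

lemma partial_eq_dir_deriv:
  assumes "real_polynomial_function u"
  shows "partial_x i u = dir_deriv (dir_x i) u" "partial_y j u = dir_deriv (dir_y j) u"
  using deriv_along_line[OF assms, of "(_, _)" "dir_x i"] deriv_along_line[OF assms, of "(_, _)" "dir_y j"]
  by (auto simp: partial_x_def partial_y_def fun_eq_iff)

text \<open>
  The direction in which \<open>y\<^sub>j\<close> grows while \<open>|y|\<close> is fixed. Together with the \<open>dir_x i\<close> and
  \<open>dir_y last_ix\<close> these are the coordinate directions of \<open>(x, y', |y|)\<close>.
\<close>

abbreviation dir_level :: "'b::{finite,linorder} \<Rightarrow> (real^'a) \<times> (real^'b::{finite,linorder})"
  where "dir_level j \<equiv> dir_y j - dir_y last_ix"

lemma dir_deriv_fields:
  fixes p :: "(real^'a) \<times> (real^'b::{finite,linorder}) \<Rightarrow> real"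
  assumes p: "real_polynomial_function p"
  shows "dir_deriv (boost i y) p z = height y * dir_deriv (dir_x i) p z + fst y $ i * dir_deriv (dir_y last_ix) p z"
    and "dir_deriv (dilation y) p z = (\<Sum>i\<in>UNIV. fst y $ i * dir_deriv (dir_x i) p z) + height y * dir_deriv (dir_y last_ix) p z"
    and "dir_deriv (stretch j y) p z = snd y $ j * dir_deriv (dir_level j) p z"
proof -
  note lin = linear_add[OF linear_dir_deriv[OF p]] linear_cmul[OF linear_dir_deriv[OF p]]
  show "dir_deriv (boost i y) p z = height y * dir_deriv (dir_x i) p z + fst y $ i * dir_deriv (dir_y last_ix) p z"
    by (simp only: boost_def lin)  (simp only: real_scaleR_def)
  show "dir_deriv (stretch j y) p z = snd y $ j * dir_deriv (dir_level j) p z"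
    by (simp only: stretch_def lin) (simp only: real_scaleR_def)
  have "(fst y, 0) = (\<Sum>i\<in>UNIV. fst y $ i *\<^sub>R (dir_x i :: (real^'a) \<times> (real^'b::{finite,linorder})))"
    by (simp add: prod_eq_iff fst_sum snd_sum vec_eq_iff axis_component if_distrib cong: if_cong)
  then show "dir_deriv (dilation y) p z = (\<Sum>i\<in>UNIV. fst y $ i * dir_deriv (dir_x i) p z) + height y * dir_deriv (dir_y last_ix) p z"
    by (simp only: dilation_def lin linear_sum[OF linear_dir_deriv[OF p]]) (simp only: real_scaleR_def)
qed

lemma dir_deriv_level:
  fixes p :: "(real^'a) \<times> (real^'b::{finite,linorder}) \<Rightarrow> real"
  assumes "real_polynomial_function p"
  shows "dir_deriv (dir_level j) p = (\<lambda>z. dir_deriv (dir_y j) p z - dir_deriv (dir_y last_ix) p z)"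
  by (rule ext) (rule linear_diff[OF linear_dir_deriv[OF assms]])

lemma dir_deriv_self:
  fixes p :: "(real^'a) \<times> (real^'b::{finite,linorder}) \<Rightarrow> real"
  assumes p: "real_polynomial_function p"
  shows "dir_deriv z p z = (\<Sum>i\<in>UNIV. fst z $ i * dir_deriv (dir_x i) p z) + height z * dir_deriv (dir_y last_ix) p z
    + (\<Sum>j\<in>UNIV - {last_ix}. snd z $ j * dir_deriv (dir_level j) p z)"
proof -
  have "z = dilation z + (\<Sum>j\<in>UNIV - {last_ix}. snd z $ j *\<^sub>R dir_level j)"
  proof -
    have 1: "fst z = fst (dilation z + (\<Sum>j\<in>UNIV - {last_ix}. snd z $ j *\<^sub>R dir_level j))"
      by (simp add: dilation_simps fst_sum)
    have 2: "snd z $ k = snd (dilation z + (\<Sum>j\<in>UNIV - {last_ix}. snd z $ j *\<^sub>R dir_level j)) $ k" for k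
    proof (cases "k = last_ix")
      case True
      then show ?thesis
        by (simp add: dilation_simps snd_sum axis_component ysum_eq ysum'_def sum_negf)
    next
      case False
      have "(\<Sum>j\<in>UNIV - {last_ix}. snd z $ j * (axis j 1 $ k - axis last_ix 1 $ k)) = 
            (\<Sum>j\<in>UNIV - {last_ix}. if k = j then snd z $ j else 0)"
        using False by (intro sum.cong) (auto simp: axis_component)
      then show ?thesis using False
        by (simp add: dilation_simps snd_sum axis_component)
    qed
    show ?thesis by (rule prod_eqI[OF 1]) (use 2 in \<open>blast intro: vec_eq_iff[THEN iffD2]\<close>)
  qed
  then have "dir_deriv z p z = dir_deriv (dilation z + (\<Sum>j\<in>UNIV - {last_ix}. snd z $ j *\<^sub>R dir_level j)) p z"
    by (rule arg_cong[where f = "\<lambda>v. dir_deriv v p z"])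
  also have "\<dots> = dir_deriv (dilation z) p z + (\<Sum>j\<in>UNIV - {last_ix}. snd z $ j *\<^sub>R dir_deriv (dir_level j) p z)"
    by (simp only: linear_add[OF linear_dir_deriv[OF p]] linear_sum[OF linear_dir_deriv[OF p]]
        linear_cmul[OF linear_dir_deriv[OF p]])
  finally show ?thesis by (simp only: dir_deriv_fields[OF p] real_scaleR_def)
qed

text \<open>
  In the coordinates \<open>(x, y', |y|)\<close> the mixed derivatives in \<open>y\<close> cancel: those that \<open>y\<^sub>j \<partial>\<^sub>j\<^sup>2\<close> produces when
  \<open>\<partial>\<^sub>j\<close> is split into the derivatives along \<open>dir_level j\<close> and along \<open>y\<^sub>d\<close> are removed by
  \<open>- 2 \<langle>y, \<nabla>\<^sub>y\<rangle> \<partial>\<^sub>d\<close>. The result is grouped by the first derivatives on which the fields act; the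
  factor of the term in \<open>|y|\<close> is \<open>2\<mu> + d\<^sub>1 - |y|\<close>.
\<close>

lemma D_B_Sigma_divergence_form:
  fixes u :: "(real^'a) \<times> (real^'b::{finite,linorder}) \<Rightarrow> real"
  assumes u: "real_polynomial_function u"
  shows "D_B_Sigma \<mu> \<kappa> u z =
    (\<Sum>i\<in>UNIV. dir_deriv (boost i z) (dir_deriv (dir_x i) u) z - fst z $ i * dir_deriv (dir_x i) u z)
    + (dir_deriv (dilation z) (dir_deriv (dir_y last_ix) u) z
        + (2 * (\<mu> - 1/2) + (real CARD('a) + 1) - height z) * dir_deriv (dir_y last_ix) u z)
    + (\<Sum>j\<in>UNIV - {last_ix}. dir_deriv (stretch j z) (dir_deriv (dir_level j) u) z
        + (\<kappa> j + 1 - snd z $ j) * dir_deriv (dir_level j) u z)"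
proof -
  \<comment> \<open>Both sides are expanded in the first and second derivatives along the original coordinates, and the
    sums over \<open>y\<close> are split into the last index and the others.\<close>
  let ?l = "last_ix :: 'b" and ?R = "UNIV - {last_ix :: 'b}"
  let ?f = "dir_deriv (dir_y ?l) u z" and ?e = "\<lambda>i. dir_deriv (dir_x i) u z"
  let ?g = "\<lambda>j. dir_deriv (dir_y j) u z"
  let ?ee = "\<lambda>i. dir_deriv (dir_x i) (dir_deriv (dir_x i) u) z"
  let ?ef = "\<lambda>i. dir_deriv (dir_x i) (dir_deriv (dir_y ?l) u) z"
  let ?gg = "\<lambda>j. dir_deriv (dir_y j) (dir_deriv (dir_y j) u) z"
  let ?gf = "\<lambda>j. dir_deriv (dir_y j) (dir_deriv (dir_y ?l) u) z"
  let ?ff = "dir_deriv (dir_y ?l) (dir_deriv (dir_y ?l) u) z"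
  have du: "real_polynomial_function (dir_deriv v u)" for v
    by (rule real_polynomial_function_dir_deriv[OF u])
  obtain x y where z: "z = (x, y)" by (cases z)
  have kap: "kappa_ext \<kappa> ?l = 0" "j \<in> ?R \<Longrightarrow> kappa_ext \<kappa> j = \<kappa> j" for j
    by (auto simp: kappa_ext_def)
  have split: "(\<Sum>j\<in>UNIV. F j) = F ?l + (\<Sum>j\<in>?R. F j)" for F :: "'b \<Rightarrow> real"
    by (simp add: sum.remove[of UNIV ?l])
  have card: "real CARD('b) = 1 + (\<Sum>j\<in>?R. 1)"
    using split[of "\<lambda>_. 1"] by simp
  have T: "height z = snd z $ ?l + (\<Sum>j\<in>?R. snd z $ j)"
    unfolding ysum_def by (rule split)
  have "D_B_Sigma \<mu> \<kappa> u z = height z * (\<Sum>i\<in>UNIV. ?ee i) + 2 * (\<Sum>i\<in>UNIV. fst z $ i * ?ef i)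
      - (\<Sum>i\<in>UNIV. fst z $ i * ?e i)
      + (\<Sum>j\<in>UNIV. snd z $ j * ?gg j + (kappa_ext \<kappa> j + 1 - snd z $ j) * ?g j)
      + 2 * height z * ?ff - 2 * (\<Sum>j\<in>UNIV. snd z $ j * ?gf j)
      + (2 * \<mu> + real CARD('a) - kappa_abs \<kappa> - real CARD('b)) * ?f"
    unfolding D_B_Sigma_def laplace_x_def euler_x_def euler_y_def
    by (simp add: z partial_eq_dir_deriv u du)
  also have "(\<Sum>j\<in>UNIV. snd z $ j * ?gg j + (kappa_ext \<kappa> j + 1 - snd z $ j) * ?g j)
      = snd z $ ?l * ?ff + (1 - snd z $ ?l) * ?f
        + (\<Sum>j\<in>?R. snd z $ j * ?gg j + (\<kappa> j + 1 - snd z $ j) * ?g j)"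
    unfolding split by (simp add: kap)
  also have "(\<Sum>j\<in>UNIV. snd z $ j * ?gf j) = snd z $ ?l * ?ff + (\<Sum>j\<in>?R. snd z $ j * ?gf j)"
    by (rule split)
  finally have lhs: "D_B_Sigma \<mu> \<kappa> u z = height z * (\<Sum>i\<in>UNIV. ?ee i) + 2 * (\<Sum>i\<in>UNIV. fst z $ i * ?ef i)
      - (\<Sum>i\<in>UNIV. fst z $ i * ?e i)
      + (snd z $ ?l * ?ff + (1 - snd z $ ?l) * ?f
        + (\<Sum>j\<in>?R. snd z $ j * ?gg j + (\<kappa> j + 1 - snd z $ j) * ?g j))
      + 2 * height z * ?ff - 2 * (snd z $ ?l * ?ff + (\<Sum>j\<in>?R. snd z $ j * ?gf j))
      + (2 * \<mu> + real CARD('a) - (\<Sum>j\<in>?R. \<kappa> j) - (1 + (\<Sum>j\<in>?R. 1))) * ?f"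
    unfolding card kappa_abs_def .
  have b: "(\<Sum>i\<in>UNIV. dir_deriv (boost i z) (dir_deriv (dir_x i) u) z - fst z $ i * dir_deriv (dir_x i) u z)
      = height z * (\<Sum>i\<in>UNIV. ?ee i) + (\<Sum>i\<in>UNIV. fst z $ i * ?ef i) - (\<Sum>i\<in>UNIV. fst z $ i * ?e i)"
    by (simp add: dir_deriv_fields[OF du] dir_deriv_commute[OF u, of "dir_y ?l" "dir_x _"]
        sum.distrib sum_subtractf sum_distrib_left)
  have d: "dir_deriv (dilation z) (dir_deriv (dir_y ?l) u) z = (\<Sum>i\<in>UNIV. fst z $ i * ?ef i) + height z * ?ff"
    by (rule dir_deriv_fields(2)[OF du])
  have "(\<Sum>j\<in>?R. dir_deriv (stretch j z) (dir_deriv (dir_level j) u) z + (\<kappa> j + 1 - snd z $ j) * dir_deriv (dir_level j) u z)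
      = (\<Sum>j\<in>?R. (snd z $ j * ?gg j + (\<kappa> j + 1 - snd z $ j) * ?g j) - 2 * (snd z $ j * ?gf j)
          + snd z $ j * ?ff - (\<kappa> j + 1 - snd z $ j) * ?f)"
  proof (rule sum.cong[OF refl])
    fix j
    have 1: "dir_deriv (dir_level j) (dir_deriv (dir_level j) u) z = ?gg j - 2 * ?gf j + ?ff"
      unfolding dir_deriv_level[OF u]
      by (simp only: dir_deriv_level[OF real_polynomial_function_diff[OF du du]] dir_deriv_diff[OF du du]
          dir_deriv_commute[OF u, of "dir_y ?l" "dir_y j"])
    have 2: "dir_deriv (dir_level j) u z = ?g j - ?f" unfolding dir_deriv_level[OF u] ..
    show "dir_deriv (stretch j z) (dir_deriv (dir_level j) u) z + (\<kappa> j + 1 - snd z $ j) * dir_deriv (dir_level j) u z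
      = (snd z $ j * ?gg j + (\<kappa> j + 1 - snd z $ j) * ?g j) - 2 * (snd z $ j * ?gf j)
          + snd z $ j * ?ff - (\<kappa> j + 1 - snd z $ j) * ?f"
      unfolding dir_deriv_fields(3)[OF du] 1 2 by (simp add: algebra_simps)
  qed
  also have "\<dots> = (\<Sum>j\<in>?R. snd z $ j * ?gg j + (\<kappa> j + 1 - snd z $ j) * ?g j)
      - 2 * (\<Sum>j\<in>?R. snd z $ j * ?gf j) + (\<Sum>j\<in>?R. snd z $ j) * ?ff
      - ((\<Sum>j\<in>?R. \<kappa> j) + (\<Sum>j\<in>?R. 1) - (\<Sum>j\<in>?R. snd z $ j)) * ?f"
    by (simp only: sum.distrib sum_subtractf sum_distrib_left[symmetric] sum_distrib_right[symmetric])
  finally have s: "(\<Sum>j\<in>?R. dir_deriv (stretch j z) (dir_deriv (dir_level j) u) z + (\<kappa> j + 1 - snd z $ j) * dir_deriv (dir_level j) u z) = \<dots>" .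
  show ?thesis
    unfolding lhs b d s T by (simp add: algebra_simps)
qed

section \<open>Symmetry and action on degrees\<close>

lemma weighted_polynomial_integrable:
  fixes p :: "(real^'a) \<times> (real^'b::{finite,linorder}) \<Rightarrow> real"
  assumes a: "a > - 1" and \<kappa>: "\<And>i. i \<noteq> last_ix \<Longrightarrow> \<kappa> i > - 1"
    and p: "real_polynomial_function p"
  shows "integrable lborel (\<lambda>z. p z * exp (- decay z) * base_weight a \<kappa> z)"
proof -
  obtain C where C: "C \<ge> 0" "\<And>z. \<bar>p z\<bar> \<le> C * exp (1/6 * norm z)"
    using real_polynomial_growth[OF p, of "1/6"] by auto
  show ?thesis
  proof (rule Bochner_Integration.integrable_bound)
    show "integrable lborel (\<lambda>z :: (real^'a) \<times> (real^'b::{finite,linorder}).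
        C * (base_weight a \<kappa> z * exp (- (1/2) * decay z)))"
      by (intro integrable_mult_right base_weight_integrable a \<kappa>) auto
    have "decay \<in> borel_measurable (borel :: ((real^'a) \<times> (real^'b::{finite,linorder})) measure)"
      by (rule linear_imp_borel[OF linear_decay])
    with real_polynomial_borel[OF p]
    show "(\<lambda>z. p z * exp (- decay z) * base_weight a \<kappa> z) \<in> borel_measurable lborel"
      by measurable
    have "norm (p z * exp (- decay z) * base_weight a \<kappa> z)
        \<le> norm (C * (base_weight a \<kappa> z * exp (- (1/2) * decay z)))" for z
    proof (cases "base_weight a \<kappa> z = 0")
      case False
      have "exp (1/6 * norm z) \<le> exp (1/2 * decay z)"
        using norm_le_decay[OF base_weight_support[OF False]] by simp
      then have "\<bar>p z\<bar> \<le> C * exp (1/2 * decay z)"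
        using C by (intro order_trans[OF C(2)] mult_left_mono) auto
      then have "\<bar>p z\<bar> * exp (- decay z) * base_weight a \<kappa> z
          \<le> C * exp (1/2 * decay z) * exp (- decay z) * base_weight a \<kappa> z"
        by (intro mult_right_mono base_weight_nonneg) auto
      also have "\<dots> = C * (base_weight a \<kappa> z * (exp (1/2 * decay z) * exp (- decay z)))"
        by (simp only: mult_ac)
      also have "exp (1/2 * decay z) * exp (- decay z) = exp (- (1/2) * decay z)"
        by (simp flip: exp_add)
      finally show ?thesis using C base_weight_nonneg[of a \<kappa> z] by (simp add: abs_mult)
    qed simp
    then show "AE z in lborel. norm (p z * exp (- decay z) * base_weight a \<kappa> z)
        \<le> norm (C * (base_weight a \<kappa> z * exp (- (1/2) * decay z)))" by simp
  qed
qed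

text \<open>
  The Dirichlet form density \<open>\<langle>A \<nabla>u, \<nabla>h\<rangle>\<close> of the coefficient matrix \<open>A\<close> of the operator.
\<close>

definition carre_du_champ ::
  "((real^'a) \<times> (real^'b::{finite,linorder}) \<Rightarrow> real) \<Rightarrow> ((real^'a) \<times> (real^'b::{finite,linorder}) \<Rightarrow> real)
    \<Rightarrow> (real^'a) \<times> (real^'b::{finite,linorder}) \<Rightarrow> real"
  where "carre_du_champ u h z =
    (\<Sum>i\<in>UNIV. dir_deriv (dir_x i) u z * dir_deriv (boost i z) h z)
    + dir_deriv (dir_y last_ix) u z * dir_deriv (dilation z) h z
    + (\<Sum>j\<in>UNIV - {last_ix}. dir_deriv (dir_level j) u z * dir_deriv (stretch j z) h z)"

text \<open>
  The coefficient matrix is symmetric: \<open>boost i\<close> has component \<open>x\<^sub>i\<close> along \<open>|y|\<close>, and \<open>dilation\<close> has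
  component \<open>x\<^sub>i\<close> along the direction of \<open>x\<^sub>i\<close>.
\<close>

lemma carre_du_champ_commute:
  assumes u: "real_polynomial_function u" and h: "real_polynomial_function h"
  shows "carre_du_champ u h z = carre_du_champ h u z"
  unfolding carre_du_champ_def dir_deriv_fields[OF u] dir_deriv_fields[OF h]
  by (simp add: distrib_left sum.distrib sum_distrib_left sum_distrib_right mult_ac)

lemma real_polynomial_carre_du_champ:
  assumes u: "real_polynomial_function u" and h: "real_polynomial_function h"
  shows "real_polynomial_function (carre_du_champ u h)"
  unfolding carre_du_champ_def[abs_def]
  by (intro real_polynomial_add real_polynomial_mult real_polynomial_function_sum finite finite_Diff
      real_polynomial_function_dir_deriv real_polynomial_function_dir_deriv_field u h linear_fields)

text \<open>
  Apart from minus the Euler operator, each term takes at least one more derivative than it has linear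
  factors.
\<close>

lemma D_B_Sigma_leading_part:
  fixes u :: "(real^'a) \<times> (real^'b::{finite,linorder}) \<Rightarrow> real"
  assumes u: "poly_below k u"
  shows "poly_below (k - 1) (\<lambda>z. D_B_Sigma \<mu> \<kappa> u z + dir_deriv z u z)"
proof -
  note rpf = poly_below_imp_real_polynomial
  note du = poly_below_dir_deriv[OF u]
  note ddu = poly_below_dir_deriv_mult[OF du]
  have eq: "D_B_Sigma \<mu> \<kappa> u z + dir_deriv z u z =
    (\<Sum>i\<in>UNIV. height z * dir_deriv (dir_x i) (dir_deriv (dir_x i) u) z
        + fst z $ i * dir_deriv (dir_y last_ix) (dir_deriv (dir_x i) u) z)
    + ((\<Sum>i\<in>UNIV. fst z $ i * dir_deriv (dir_x i) (dir_deriv (dir_y last_ix) u) z)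
        + height z * dir_deriv (dir_y last_ix) (dir_deriv (dir_y last_ix) u) z)
    + (2 * (\<mu> - 1/2) + (real CARD('a) + 1)) * dir_deriv (dir_y last_ix) u z
    + (\<Sum>j\<in>UNIV - {last_ix}. snd z $ j * dir_deriv (dir_level j) (dir_deriv (dir_level j) u) z
        + (\<kappa> j + 1) * dir_deriv (dir_level j) u z)" for z
    unfolding D_B_Sigma_divergence_form[OF rpf[OF u]] dir_deriv_self[OF rpf[OF u]] dir_deriv_fields[OF rpf[OF du]]
    by (simp add: sum.distrib sum_subtractf left_diff_distrib algebra_simps)
  show ?thesis unfolding eq
    by (intro poly_below.add poly_below_sum ddu poly_below_cmult du bounded_linear_height bounded_linear_coordinates)
qed

lemma D_B_Sigma_lowers_degree:
  assumes u: "poly_below k u"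
  shows "poly_below (k - 1) (\<lambda>z. D_B_Sigma \<mu> \<kappa> u z + real (k - 1) * u z)"
  using poly_below.add[OF D_B_Sigma_leading_part[OF u, of \<mu> \<kappa>] poly_below_euler[OF u]]
  by (simp add: algebra_simps)

lemma D_B_Sigma_preserves_degree:
  assumes u: "poly_below k u"
  shows "poly_below k (D_B_Sigma \<mu> \<kappa> u)"
proof -
  have "poly_below k (\<lambda>z. (D_B_Sigma \<mu> \<kappa> u z + real (k - 1) * u z) - real (k - 1) * u z)"
    by (rule poly_below_diff[OF poly_below_mono[OF D_B_Sigma_lowers_degree[OF u]] poly_below_cmult[OF u]]) simp
  then show ?thesis by simp
qed

context
  fixes \<mu> :: real and \<kappa> :: "'b::{finite,linorder} \<Rightarrow> real"
  assumes \<mu>: "\<mu> > - 1/2" and \<kappa>: "\<And>i. i \<noteq> last_ix \<Longrightarrow> \<kappa> i > - 1"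
begin

lemma weighted_integrable:
  fixes p :: "(real^'a) \<times> (real^'b::{finite,linorder}) \<Rightarrow> real"
  assumes "real_polynomial_function p"
  shows "integrable lborel (\<lambda>z. p z * exp (- decay z) * base_weight (\<mu> - 1/2) \<kappa> z)"
  using \<mu> by (intro weighted_polynomial_integrable \<kappa> assms) auto

lemma weighted_integral_add:
  fixes p q :: "(real^'a) \<times> (real^'b::{finite,linorder}) \<Rightarrow> real"
  assumes "real_polynomial_function p" "real_polynomial_function q"
  shows "weighted_integral (\<mu> - 1/2) \<kappa> (\<lambda>z. p z + q z)
    = weighted_integral (\<mu> - 1/2) \<kappa> p + weighted_integral (\<mu> - 1/2) \<kappa> q"
  unfolding weighted_integral_def distrib_right
  by (intro Bochner_Integration.integral_add weighted_integrable assms)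

lemma weighted_integral_sum:
  fixes p :: "'i \<Rightarrow> (real^'a) \<times> (real^'b::{finite,linorder}) \<Rightarrow> real"
  assumes "\<And>i. i \<in> I \<Longrightarrow> real_polynomial_function (p i)"
  shows "weighted_integral (\<mu> - 1/2) \<kappa> (\<lambda>z. \<Sum>i\<in>I. p i z) = (\<Sum>i\<in>I. weighted_integral (\<mu> - 1/2) \<kappa> (p i))"
  unfolding weighted_integral_def sum_distrib_right
  by (intro Bochner_Integration.integral_sum weighted_integrable assms)

lemma weighted_integral_cmult:
  fixes p :: "(real^'a) \<times> (real^'b::{finite,linorder}) \<Rightarrow> real"
  shows "weighted_integral (\<mu> - 1/2) \<kappa> (\<lambda>z. c * p z) = c * weighted_integral (\<mu> - 1/2) \<kappa> p"
  unfolding weighted_integral_def mult.assoc by simp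

text \<open>
  Each summand of the divergence form, multiplied by \<open>h\<close>, differs from an integrand \<open>W\<^sup>-\<^sup>1 div (W g h V)\<close>
  of integral zero by a summand of the Dirichlet form density (Leibniz rule for \<open>g h\<close>).
\<close>

lemma green_identity:
  fixes u h :: "(real^'a) \<times> (real^'b::{finite,linorder}) \<Rightarrow> real"
  assumes u: "real_polynomial_function u" and h: "real_polynomial_function h"
  shows "weighted_integral (\<mu> - 1/2) \<kappa> (\<lambda>z. D_B_Sigma \<mu> \<kappa> u z * h z + carre_du_champ u h z) = 0"
proof -
  have a: "\<mu> - 1/2 > - 1" using \<mu> by simp
  define e where "e i = (\<lambda>z. dir_deriv (dir_x i) u z * h z)" for i
  define f where "f = (\<lambda>z. dir_deriv (dir_y last_ix) u z * h z)"
  define s where "s j = (\<lambda>z. dir_deriv (dir_level j) u z * h z)" for j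
  note du = real_polynomial_function_dir_deriv[OF u]
  have rpf: "real_polynomial_function (e i)" "real_polynomial_function f" "real_polynomial_function (s j)" for i j
    unfolding e_def f_def s_def by (intro real_polynomial_mult du h)+
  have prod: "dir_deriv v (\<lambda>z. dir_deriv w u z * h z) z
      = dir_deriv w u z * dir_deriv v h z + dir_deriv v (dir_deriv w u) z * h z" for v w z
    by (rule dir_deriv_mult[OF du h])
  let ?b = "\<lambda>i z. dir_deriv (boost i z) (e i) z - fst z $ i * e i z"
  let ?d = "\<lambda>z. dir_deriv (dilation z) f z + (2 * (\<mu> - 1/2) + (real CARD('a) + 1) - height z) * f z"
  let ?s = "\<lambda>j z. dir_deriv (stretch j z) (s j) z + (\<kappa> j + 1 - snd z $ j) * s j z"
  have "D_B_Sigma \<mu> \<kappa> u z * h z + carre_du_champ u h z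
      = (\<Sum>i\<in>UNIV. ?b i z) + ?d z + (\<Sum>j\<in>UNIV - {last_ix}. ?s j z)" for z
    unfolding D_B_Sigma_divergence_form[OF u] carre_du_champ_def e_def f_def s_def prod
    by (simp add: distrib_right left_diff_distrib sum_distrib_right sum.distrib sum_subtractf mult.assoc)
  moreover have rb: "real_polynomial_function (?b i)" for i
    by (intro real_polynomial_function_diff real_polynomial_mult real_polynomial_function_dir_deriv_field
        rpf linear_fields real_polynomial_linear bounded_linear_coordinates)
  moreover have rd: "real_polynomial_function ?d"
    by (intro real_polynomial_add real_polynomial_function_diff real_polynomial_mult real_polynomial_function_dir_deriv_field
        rpf linear_fields real_polynomial_linear bounded_linear_height real_polynomial_const)
  moreover have rs: "real_polynomial_function (?s j)" for j
    by (intro real_polynomial_add real_polynomial_function_diff real_polynomial_mult real_polynomial_function_dir_deriv_field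
        rpf linear_fields real_polynomial_linear bounded_linear_coordinates real_polynomial_const)
  moreover have "weighted_integral (\<mu> - 1/2) \<kappa> (?b i) = 0" for i
    unfolding weighted_integral_def by (rule boost_integral[OF a \<kappa> rpf(1)])
  moreover have "weighted_integral (\<mu> - 1/2) \<kappa> ?d = 0"
    unfolding weighted_integral_def by (rule dilation_integral[OF a \<kappa> rpf(2)])
  moreover have "weighted_integral (\<mu> - 1/2) \<kappa> (?s j) = 0" if "j \<noteq> last_ix" for j
    unfolding weighted_integral_def by (rule stretch_integral[OF a \<kappa> rpf(3) that])
  ultimately show ?thesis
    by (simp add: weighted_integral_add weighted_integral_sum real_polynomial_add real_polynomial_function_sum)
qed

lemma D_B_Sigma_symmetric:
  fixes u h :: "(real^'a) \<times> (real^'b::{finite,linorder}) \<Rightarrow> real"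
  assumes u: "poly_below j u" and h: "poly_below k h"
  shows "weighted_integral (\<mu> - 1/2) \<kappa> (\<lambda>z. D_B_Sigma \<mu> \<kappa> u z * h z)
    = weighted_integral (\<mu> - 1/2) \<kappa> (\<lambda>z. u z * D_B_Sigma \<mu> \<kappa> h z)"
proof -
  have half: "weighted_integral (\<mu> - 1/2) \<kappa> (\<lambda>z. D_B_Sigma \<mu> \<kappa> v z * w z)
      = - weighted_integral (\<mu> - 1/2) \<kappa> (carre_du_champ v w)"
    if "poly_below m v" "poly_below l w" for m l and v w :: "(real^'a) \<times> (real^'b::{finite,linorder}) \<Rightarrow> real"
  proof -
    have v: "real_polynomial_function v" and w: "real_polynomial_function w"
      and Dv: "real_polynomial_function (D_B_Sigma \<mu> \<kappa> v)"
      using that by (auto intro: poly_below_imp_real_polynomial D_B_Sigma_preserves_degree)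
    have "weighted_integral (\<mu> - 1/2) \<kappa> (\<lambda>z. D_B_Sigma \<mu> \<kappa> v z * w z)
        + weighted_integral (\<mu> - 1/2) \<kappa> (carre_du_champ v w) = 0"
      using green_identity[OF v w]
        weighted_integral_add[OF real_polynomial_mult[OF Dv w] real_polynomial_carre_du_champ[OF v w]]
      by simp
    then show ?thesis by linarith
  qed
  have "carre_du_champ u h = carre_du_champ h u"
    using carre_du_champ_commute poly_below_imp_real_polynomial u h by blast
  with half[OF u h] half[OF h u] show ?thesis by (simp add: mult.commute)
qed

text \<open>
  The weight is positive on the interior of the domain, so a polynomial of norm zero vanishes there
  almost everywhere, hence throughout the interior by continuity, hence identically.
\<close>

lemma weighted_square_zero:
  fixes f :: "(real^'a) \<times> (real^'b::{finite,linorder}) \<Rightarrow> real"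
  assumes f: "real_polynomial_function f"
    and 0: "weighted_integral (\<mu> - 1/2) \<kappa> (\<lambda>z. f z * f z) = 0"
  shows "f z = 0"
proof -
  define U :: "((real^'a) \<times> (real^'b::{finite,linorder})) set"
    where "U = (\<Inter>j\<in>UNIV - {last_ix}. {z. 0 < snd z $ j}) \<inter> {z. norm (fst z) < height z}"
  have U: "open U" unfolding U_def
    by (intro open_Int open_INT ballI open_Collect_less continuous_intros) auto
  have "((0, \<chi> j. 1) :: (real^'a) \<times> (real^'b::{finite,linorder})) \<in> U"
    by (simp add: U_def ysum_def)
  then have U_ne: "U \<noteq> {}" by blast
  have pos: "base_weight (\<mu> - 1/2) \<kappa> z > 0" if "z \<in> U" for z
  proof -
    have "(norm (fst z))\<^sup>2 < (height z)\<^sup>2" using that by (auto simp: U_def intro!: power_strict_mono)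
    then have "(height z)\<^sup>2 - (norm (fst z))\<^sup>2 > 0" by simp
    moreover have "z \<in> B_Sigma" using that by (auto simp: U_def mem_B_Sigma_iff less_imp_le)
    moreover have "(\<Prod>i\<in>UNIV - {last_ix}. (snd z $ i) powr \<kappa> i) > 0"
    proof (rule prod_pos)
      fix j :: 'b assume "j \<in> UNIV - {last_ix}"
      then have "0 < snd z $ j" using that by (auto simp: U_def)
      then show "0 < (snd z $ j) powr \<kappa> j" by simp
    qed
    ultimately show ?thesis by (simp add: base_weight_def)
  qed
  have "AE z in lborel. f z * f z * exp (- decay z) * base_weight (\<mu> - 1/2) \<kappa> z = 0"
    using 0 integral_nonneg_eq_0_iff_AE[OF weighted_integrable[OF real_polynomial_mult[OF f f]]]
    unfolding weighted_integral_def
    by (simp add: mult_nonneg_nonneg base_weight_nonneg del: mult_eq_0_iff)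
  then have "AE z in lborel. z \<notin> {z \<in> U. f z \<noteq> 0}"
    by eventually_elim (auto dest: pos)
  moreover have op: "open {z \<in> U. f z \<noteq> 0}"
  proof -
    have "continuous_on UNIV f"
      using continuous_on_polymonial_function f by (simp add: real_polynomial_function_eq)
    then have "open {z. f z \<noteq> 0}" by (intro open_Collect_neq) (auto intro: continuous_intros)
    from open_Int[OF U this] show ?thesis by (simp only: Int_def mem_Collect_eq)
  qed
  ultimately have "{z \<in> U. f z \<noteq> 0} \<in> null_sets lborel"
    by (subst (asm) AE_iff_null_sets[symmetric]) (auto intro: borel_open)
  then have "negligible {z \<in> U. f z \<noteq> 0}"
    by (simp add: negligible_iff_null_sets null_sets_completionI)
  then have "{z \<in> U. f z \<noteq> 0} = {}" using open_not_negligible[OF op] by blast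
  then show ?thesis
    using real_polynomial_zero_if_zero_on_open[OF f U U_ne] by blast
qed

end

section \<open>The eigenvalue equation\<close>

theorem theorem5p2:
  fixes \<mu> :: real
    and \<kappa> :: "'b::{finite,linorder} \<Rightarrow> real"
    and n :: nat
    and u :: "(real^'a) \<times> (real^'b::{finite,linorder}) \<Rightarrow> real"
  assumes "\<mu> > - 1/2"
    and "\<And>i. i \<noteq> last_ix \<Longrightarrow> \<kappa> i > - 1"
    and "u \<in> orth_polys B_Sigma (W_B_Sigma \<mu> \<kappa>) n"
  shows "D_B_Sigma \<mu> \<kappa> u = (\<lambda>z. - real n * u z)"
proof -
  let ?I = "weighted_integral (\<mu> - 1/2) \<kappa> :: ((real^'a) \<times> (real^'b::{finite,linorder}) \<Rightarrow> real) \<Rightarrow> real"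
  have u: "poly_below (Suc n) u"
    using assms(3) poly_below.zero by (auto simp: orth_polys_def poly_deg_eq_def poly_deg_less_iff_poly_below)
  have orth: "?I (\<lambda>z. u z * q z) = 0" if "poly_below n q" for q
    using assms(3) that by (simp add: orth_polys_def poly_deg_less_iff_poly_below set_integral_B_Sigma)
  define f where "f = (\<lambda>z. D_B_Sigma \<mu> \<kappa> u z + real n * u z)"
  have f: "poly_below n f"
    unfolding f_def using D_B_Sigma_lowers_degree[OF u] by simp
  note rpf = poly_below_imp_real_polynomial
  have "?I (\<lambda>z. f z * f z) = ?I (\<lambda>z. D_B_Sigma \<mu> \<kappa> u z * f z + real n * (u z * f z))"
    by (simp add: f_def distrib_right mult.assoc)
  also have "\<dots> = ?I (\<lambda>z. D_B_Sigma \<mu> \<kappa> u z * f z) + real n * ?I (\<lambda>z. u z * f z)"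
    using weighted_integral_add[where \<kappa> = \<kappa>, OF assms(1,2), where p = "\<lambda>z. D_B_Sigma \<mu> \<kappa> u z * f z" and q = "\<lambda>z. real n * (u z * f z)"]
      weighted_integral_cmult[where \<kappa> = \<kappa>, OF assms(1,2), where c = "real n" and p = "\<lambda>z. u z * f z"]
      rpf[OF D_B_Sigma_preserves_degree[OF u]] rpf[OF u] rpf[OF f]
    by (simp add: real_polynomial_mult real_polynomial_const)
  also have "\<dots> = ?I (\<lambda>z. u z * D_B_Sigma \<mu> \<kappa> f z) + real n * ?I (\<lambda>z. u z * f z)"
    using D_B_Sigma_symmetric[where \<kappa> = \<kappa>, OF assms(1,2) u f] by simp
  also have "\<dots> = 0"
    using orth[OF D_B_Sigma_preserves_degree[OF f]] orth[OF f] by simp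
  finally have "f z = 0" for z
    using weighted_square_zero[where \<kappa> = \<kappa>, OF assms(1,2) rpf[OF f]] by blast
  then show ?thesis by (auto simp: f_def fun_eq_iff eq_neg_iff_add_eq_0)
qed

end
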